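(* Let $\mathcal{H}$, $\mathcal{G}$, $\mathcal{J}$, $\mathcal{K}$ be real Hilbert spaces, let $g\in\Gamma_0(\mathcal{K})$, let $h\in\Gamma_0(\mathcal{J})$, and let $T\colon\mathcal{K}\to\mathcal{G}$, $J\colon\mathcal{J}\to\mathcal{H}$, and $K\colon\mathcal{G}\to\mathcal{H}$ be non-zero bounded linear operators such that $0\in\mathrm{sri}(\mathrm{dom}\,g^*-\mathrm{ran}\,T^* )$, $0\in\mathrm{sri}(\mathrm{dom}\,h^*-\mathrm{ran}\,J^* )$, and $0\in\mathrm{sri}(KT\,\mathrm{dom}\,g+J\,\mathrm{dom}\,h)$. Consider the convex optimization problem $$(\mathrm{Q})\quad\min_{y\in\mathcal{K}}\min_{v\in\mathcal{J}}\ g(y)+h(v)\quad\text{s.t.}\quad KTy+Jv=0,$$ under the assumption that solutions exist. Let $\Sigma\colon\mathcal{G}\to\mathcal{G}$ and $\Upsilon\colon\mathcal{H}\to\mathcal{H}$ be strongly monotone self-adjoint linear operators such that $\Sigma^{-1}-K^*\Upsilon K$ is monotone, let $p_0\in\mathcal{K}$, $v_0\in\mathcal{J}$, $x_0\in\mathcal{H}$, and consider the routine: for every $n\in\mathbb{N}$, $$\begin{aligned} y_n&=x_n+\Upsilon(KTp_n+Jv_n),\\ p_{n+1}&\in\operatorname*{argmin}_{p\in\mathcal{K}}\Big(g(p)+\tfrac12\|Tp-(Tp_n-\Sigma K^*y_n)\|_{\Sigma^{-1}}^2\Big),\\ v_{n+1}&\in\operatorname*{argmin}_{v\in\mathcal{J}}\Big(h(v)+\tfrac12\|Jv+KTp_{n+1}+\Upsilon^{-1}x_n\|_{\Upsilon}^2\Big),\\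 x_{n+1}&=x_n+\Upsilon(KTp_{n+1}+Jv_{n+1}).\end{aligned}$$ Then there exists a solution $(\hat y,\hat v)$ to (Q) such that the following hold: (i) $Tp_n\rightharpoonup T\hat y$ and $Jv_n\rightharpoonup J\hat v$. (ii) Suppose that $\mathrm{ran}\,T^*=\mathcal{K}$. Then $p_n\rightharpoonup\hat y$. (iii) Suppose that $\mathrm{ran}\,J^*=\mathcal{J}$. Then $v_n\rightharpoonup\hat v$.
   Context: $\Gamma_0(\mathcal{K})$ is the class of proper lower semicontinuous convex functions from $\mathcal{K}$ to $]-\infty,+\infty]$; $g^*$ is the Fenchel conjugate; $\mathrm{dom}\,g=\{g<+\infty\}$. $T^*,J^*,K^*$ are adjoints and $\mathrm{ran}$ denotes range. $\mathrm{sri}\,C$ (strong relative interior of a convex set $C$) is the set of $x\in C$ such that the cone generated by $C-x$ is a closed linear subspace. A self-adjoint linear operator $\Upsilon$ is strongly monotone if $\langle x\mid\Upsilon x\rangle\ge\beta\|x\|^2$ for some $\beta>0$ and all $x$; $\|x\|_{\Upsilon}=\sqrt{\langle x\mid\Upsilon x\rangle}$. $\rightharpoonup$ is weak convergence. *)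

theory Defs
  imports "HOL-Analysis.Analysis"
begin

text \<open>
  Real Hilbert spaces are types of sort \<open>{real_inner, banach}\<close>. Functions with values in
  \<open>]-\<infinity>,+\<infinity>]\<close> have codomain \<open>ereal\<close>; that \<open>-\<infinity>\<close> is not attained is part of the
  definition of the class \<open>Gamma0\<close>.
\<close>

definition edom :: "('a \<Rightarrow> ereal) \<Rightarrow> 'a set" where
  "edom f = {x. f x < \<infinity>}"

definition proper :: "('a \<Rightarrow> ereal) \<Rightarrow> bool" where
  "proper f \<longleftrightarrow> (\<forall>x. f x \<noteq> -\<infinity>) \<and> edom f \<noteq> {}"

definition lower_semicontinuous :: "('a::topological_space \<Rightarrow> ereal) \<Rightarrow> bool" where
  "lower_semicontinuous f \<longleftrightarrow> (\<forall>x. f x \<le> Liminf (nhds x) f)"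

text \<open>The endpoints \<open>t = 0, 1\<close> are trivial, and no sum \<open>\<infinity> + (-\<infinity>)\<close> occurs for proper \<open>f\<close>.\<close>

definition convex_function :: "('a::real_vector \<Rightarrow> ereal) \<Rightarrow> bool" where
  "convex_function f \<longleftrightarrow>
     (\<forall>x y. \<forall>t\<in>{0<..<1::real}.
        f ((1 - t) *\<^sub>R x + t *\<^sub>R y) \<le> ereal (1 - t) * f x + ereal t * f y)"

definition Gamma0 :: "('a::{real_inner, banach} \<Rightarrow> ereal) set" where
  "Gamma0 = {f. proper f \<and> lower_semicontinuous f \<and> convex_function f}"

definition fenchel_conjugate :: "('a::real_inner \<Rightarrow> ereal) \<Rightarrow> 'a \<Rightarrow> ereal" where
  "fenchel_conjugate f u = (SUP x. ereal (x \<bullet> u) - f x)"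

text \<open>
  The library's cones are closed under multiplication by \<open>0\<close> as well; since \<open>0 \<in> C - x\<close>, the
  cone hull here is the union of the positive multiples of \<open>C - x\<close>.
\<close>

definition sri :: "'a::real_normed_vector set \<Rightarrow> 'a set" where
  "sri C = {x \<in> C. closed (cone hull ((\<lambda>c. c - x) ` C)) \<and>
                   subspace (cone hull ((\<lambda>c. c - x) ` C))}"

text \<open>
  On sets, \<open>+\<close> is the Minkowski sum, but \<open>-\<close> is the set-theoretic difference.
\<close>

definition minkowski_diff :: "'a::minus set \<Rightarrow> 'a set \<Rightarrow> 'a set" where
  "minkowski_diff A B = {a - b | a b. a \<in> A \<and> b \<in> B}"

definition self_adjoint :: "('a::real_inner \<Rightarrow> 'a) \<Rightarrow> bool" where
  "self_adjoint A \<longleftrightarrow> (\<forall>x y. A x \<bullet> y = x \<bullet> A y)"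

definition strongly_monotone :: "('a::real_inner \<Rightarrow> 'a) \<Rightarrow> bool" where
  "strongly_monotone A \<longleftrightarrow> (\<exists>\<beta>>0. \<forall>x. x \<bullet> A x \<ge> \<beta> * (norm x)\<^sup>2)"

definition monotone_operator :: "('a::real_inner \<Rightarrow> 'a) \<Rightarrow> bool" where
  "monotone_operator A \<longleftrightarrow> (\<forall>x y. (x - y) \<bullet> (A x - A y) \<ge> 0)"

definition norm_wrt :: "('a::real_inner \<Rightarrow> 'a) \<Rightarrow> 'a \<Rightarrow> real" where
  "norm_wrt A x = sqrt (x \<bullet> A x)"

definition weakly_converges :: "(nat \<Rightarrow> 'a::real_inner) \<Rightarrow> 'a \<Rightarrow> bool" where
  "weakly_converges X l \<longleftrightarrow> (\<forall>z. (\<lambda>n. X n \<bullet> z) \<longlonglongrightarrow> l \<bullet> z)"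

definition solves_Q ::
  "('k \<Rightarrow> ereal) \<Rightarrow> ('j \<Rightarrow> ereal) \<Rightarrow> ('k \<Rightarrow> 'g) \<Rightarrow> ('j \<Rightarrow> 'h::real_vector) \<Rightarrow> ('g \<Rightarrow> 'h)
     \<Rightarrow> 'k \<Rightarrow> 'j \<Rightarrow> bool" where
  "solves_Q g h T J K y v \<longleftrightarrow>
     is_arg_min (\<lambda>(y, v). g y + h v) (\<lambda>(y, v). K (T y) + J v = 0) (y, v)"

end

theory Submission
  imports Defs "HOL-Library.Diagonal_Subsequence"
begin

text \<open>
  Put \<open>\<phi> = g\<^sup>* \<circ> T\<^sup>*\<close> and \<open>\<psi> = h\<^sup>* \<circ> J\<^sup>*\<close>. By the optimality conditions of the two minimisation
  steps, \<open>(T p\<^sub>n\<^sub>+\<^sub>1, x\<^sub>n)\<close> is a primal-dual (Chambolle--Pock) iteration for the saddle conditions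
  \<open>a \<in> \<partial>\<phi>(-K\<^sup>* x)\<close>, \<open>-K a \<in> \<partial>\<psi>(-x)\<close>, which is Fejer monotone in the seminorm of the positive, possibly
  degenerate operator \<open>M (a, x) = (\<Sigma>\<^sup>-\<^sup>1 a + K\<^sup>* x, K a + \<Upsilon>\<^sup>-\<^sup>1 x)\<close>. Strong monotonicity of \<open>\<Sigma>\<^sup>-\<^sup>1\<close> and
  \<open>\<Upsilon>\<^sup>-\<^sup>1\<close> bounds the iterates and makes \<open>M\<close> injective on differences of saddle points, so Opial's
  argument yields weak convergence. The third qualification condition gives a saddle point (a
  Lagrange multiplier for (Q)); the first two give the chain rules for \<open>\<partial>\<phi>\<close> and \<open>\<partial>\<psi>\<close> that lift the
  weak limits \<open>a\<close> and \<open>-K a\<close> to \<open>T y\<close> and \<open>J v\<close>. All three uses rest on one Attouch--Brezis theorem.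
\<close>

subsection \<open>Projections, Riesz representation and adjoints\<close>

text \<open>The routine controls only \<open>T p\<close> and \<open>J v\<close>, not
  \<open>p\<close> and \<open>v\<close>, and pushing \<open>g\<close> forward along \<open>T\<close>
  may destroy lower semicontinuity; the pullback of the conjugate along the adjoint always has a
  closed convex epigraph. The price is the way back: from a subgradient \<open>a\<close> of the
  pullback to a point \<open>p\<close> with \<open>T p = a\<close>. The sequences are paired with a
  shift. The step producing \<open>p 1\<close> uses \<open>y 0\<close>, which comes from arbitrary
  starting points; afterwards \<open>y (Suc n)\<close> equals \<open>2 x (Suc n) - x n\<close>, the
  extrapolation of the primal-dual method. Hence \<open>T (p (Suc n))\<close> goes with
  \<open>x n\<close>. The operator \<open>inv \<Sigma> - K* \<Upsilon> K\<close> is merely monotone,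
  so the quadratic form of \<open>M\<close> need not dominate the norm, and Fejer monotonicity
  bounds only the image of the error under \<open>M\<close>. Each step, however, depends on the past
  only through that image. Functions enter through epigraphs with real heights, which turns every
  use of a qualification condition into a statement about one linear functional on one closed convex
  set.\<close>

lemma hilbert_projection:
  fixes S :: "'a::{real_inner, banach} set"
  assumes "closed S" "convex S" "S \<noteq> {}"
  shows "\<exists>z\<in>S. \<forall>y\<in>S. (x - z) \<bullet> (y - z) \<le> 0"
proof -
  define D where "D = (\<lambda>y. (dist x y)\<^sup>2) ` S"
  define d where "d = Inf D"
  have bdd: "bdd_below D" by (auto simp: D_def intro!: bdd_belowI[of _ 0])
  have d_le: "d \<le> (dist x y)\<^sup>2" if "y \<in> S" for y
    unfolding d_def using bdd that by (intro cInf_lower) (auto simp: D_def)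
  have "\<exists>y\<in>S. (dist x y)\<^sup>2 < d + inverse (real (Suc n))" for n
  proof -
    have "\<exists>u\<in>D. u < d + inverse (real (Suc n))"
      unfolding d_def using assms bdd by (intro cInf_lessD) (auto simp: D_def)
    then show ?thesis by (auto simp: D_def)
  qed
  then obtain Y where Y: "\<And>n. Y n \<in> S" "\<And>n. (dist x (Y n))\<^sup>2 < d + inverse (real (Suc n))"
    by metis
  have parallelogram: "(dist (Y n) (Y m))\<^sup>2 \<le> 2 * inverse (real (Suc n)) + 2 * inverse (real (Suc m))"
    for n m
  proof -
    \<comment> \<open>The midpoint of two near-minimisers stays in \<open>S\<close>, so its distance
      is at least \<open>d\<close>; the parallelogram identity then forces near-minimisers close
      together.\<close>
    let ?w = "(1/2) *\<^sub>R Y n + (1/2) *\<^sub>R Y m"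
    have "?w \<in> S" using assms Y by (intro convexD) auto
    then have "d \<le> (dist x ?w)\<^sup>2" by (rule d_le)
    moreover have "(dist (Y n) (Y m))\<^sup>2 + 4 * (dist x ?w)\<^sup>2 = 2 * (dist x (Y n))\<^sup>2 + 2 * (dist x (Y m))\<^sup>2"
      unfolding dist_norm power2_norm_eq_inner
      by (simp add: inner_diff_left inner_diff_right inner_add_left inner_add_right inner_commute
        algebra_simps)
    ultimately show ?thesis using Y(2)[of n] Y(2)[of m] by simp
  qed
  have "Cauchy Y"
  proof (rule metric_CauchyI)
    fix e :: real assume "e > 0"
    then obtain N where N: "inverse (real (Suc N)) < e\<^sup>2 / 4"
      using reals_Archimedean[of "e\<^sup>2 / 4"] by auto
    have "dist (Y m) (Y n) < e" if "m \<ge> N" "n \<ge> N" for m n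
    proof -
      have "inverse (real (Suc m)) \<le> inverse (real (Suc N))" "inverse (real (Suc n)) \<le> inverse (real (Suc N))"
        using that by (auto intro!: le_imp_inverse_le)
      then have "(dist (Y m) (Y n))\<^sup>2 < e\<^sup>2"
        using parallelogram[of m n] N by linarith
      then show ?thesis using \<open>e > 0\<close> by (simp add: power_less_imp_less_base)
    qed
    then show "\<exists>M. \<forall>m\<ge>M. \<forall>n\<ge>M. dist (Y m) (Y n) < e" by blast
  qed
  then obtain z where z: "Y \<longlonglongrightarrow> z" using Cauchy_convergent_iff convergent_def by blast
  have "z \<in> S" using assms(1) Y(1) z closed_sequentially by blast
  have "(dist x z)\<^sup>2 \<le> d"
  proof (rule LIMSEQ_le)
    show "(\<lambda>n. (dist x (Y n))\<^sup>2) \<longlonglongrightarrow> (dist x z)\<^sup>2" by (intro tendsto_intros z)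
    show "(\<lambda>n. d + inverse (real (Suc n))) \<longlonglongrightarrow> d"
      using LIMSEQ_inverse_real_of_nat_add[of d] by simp
    show "\<exists>N. \<forall>n\<ge>N. (dist x (Y n))\<^sup>2 \<le> d + inverse (real (Suc n))"
      using Y(2) less_imp_le by blast
  qed
  then have closest: "dist x z \<le> dist x w" if "w \<in> S" for w
    using d_le[OF that] by (meson order_trans power2_le_imp_le zero_le_dist)
  then show ?thesis
    using any_closest_point_dot[OF assms(2,1) \<open>z \<in> S\<close>] \<open>z \<in> S\<close> by blast
qed

text \<open>Moving the projection by \<open>u\<close> and by \<open>- u\<close> inside the subspace
  turns the variational inequality into an equation.\<close>

lemma orthogonal_decomposition:
  fixes V :: "'a::{real_inner, banach} set"
  assumes "closed V" "subspace V"
  shows "\<exists>z\<in>V. \<forall>u\<in>V. (x - z) \<bullet> u = 0"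
proof -
  have "V \<noteq> {}" using subspace_0[OF assms(2)] by auto
  then obtain z where z: "z \<in> V" "\<And>y. y \<in> V \<Longrightarrow> (x - z) \<bullet> (y - z) \<le> 0"
    using hilbert_projection[OF assms(1) subspace_imp_convex[OF assms(2)]] by blast
  have "(x - z) \<bullet> u = 0" if "u \<in> V" for u
  proof -
    have "z + u \<in> V" "z - u \<in> V"
      using z(1) that assms(2) by (simp_all add: subspace_add subspace_diff)
    from z(2)[OF this(1)] z(2)[OF this(2)] show ?thesis by simp
  qed
  with z(1) show ?thesis by blast
qed

text \<open>The kernel is closed of codimension at most one, so a vector orthogonal to it, suitably
  scaled, represents the functional.\<close>

lemma riesz_representation:
  fixes f :: "'a::{real_inner, banach} \<Rightarrow> real"
  assumes "bounded_linear f"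
  shows "\<exists>u. \<forall>x. f x = u \<bullet> x"
proof (cases "\<forall>x. f x = 0")
  case True then show ?thesis by (intro exI[of _ 0]) simp
next
  case False
  interpret f: bounded_linear f by fact
  obtain a where a: "f a \<noteq> 0" using False by blast
  define V where "V = {x. f x = 0}"
  have "closed V" unfolding V_def
    by (intro closed_Collect_eq continuous_intros assms linear_continuous_on)
  moreover have "subspace V" by (auto simp: V_def subspace_def f.add f.scaleR)
  ultimately obtain z where z: "z \<in> V" "\<And>u. u \<in> V \<Longrightarrow> (a - z) \<bullet> u = 0"
    using orthogonal_decomposition by blast
  define e where "e = a - z"
  have fe: "f e = f a" using z(1) by (simp add: e_def f.diff V_def)
  then have "e \<noteq> 0" using a f.zero by force
  have "f x = ((f e / (e \<bullet> e)) *\<^sub>R e) \<bullet> x" for x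
  proof -
    have "x - (f x / f e) *\<^sub>R e \<in> V" using a fe by (simp add: V_def f.diff f.scaleR)
    then have "e \<bullet> (x - (f x / f e) *\<^sub>R e) = 0" using z(2) by (simp add: e_def)
    then show ?thesis using \<open>e \<noteq> 0\<close> a fe by (simp add: inner_diff_right field_simps)
  qed
  then show ?thesis by blast
qed

text \<open>\<open>adjoint\<close> is a Hilbert choice, so the defining identity is available only
  once some adjoint exists; Riesz representation, applied for each \<open>y\<close>, provides
  one.\<close>

lemma adjoint_inner:
  fixes A :: "'a::{real_inner, banach} \<Rightarrow> 'b::real_inner"
  assumes "bounded_linear A"
  shows "A x \<bullet> y = x \<bullet> adjoint A y"
proof -
  have "\<exists>u. \<forall>x. A x \<bullet> y = x \<bullet> u" for y
  proof -
    have "bounded_linear (\<lambda>x. A x \<bullet> y)"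
      using assms by (rule bounded_linear_compose[OF bounded_linear_inner_left])
    then show ?thesis using riesz_representation by (metis inner_commute)
  qed
  then have "\<exists>A'. \<forall>x y. A x \<bullet> y = x \<bullet> A' y" by metis
  then have "\<forall>x y. A x \<bullet> y = x \<bullet> adjoint A y"
    unfolding adjoint_def by (rule someI_ex)
  then show ?thesis by blast
qed

lemma adjoint_bounded_linear:
  fixes A :: "'a::{real_inner, banach} \<Rightarrow> 'b::real_inner"
  assumes "bounded_linear A"
  shows "bounded_linear (adjoint A)"
proof -
  interpret A: bounded_linear A by fact
  obtain B where B: "B > 0" "\<And>x. norm (A x) \<le> norm x * B" using A.pos_bounded by blast
  show ?thesis
  proof (rule bounded_linear_intro)
    have adj: "z \<bullet> adjoint A w = A z \<bullet> w" for z w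
      by (simp add: adjoint_inner[OF assms])
    show "adjoint A (x + y) = adjoint A x + adjoint A y" for x y
    proof -
      have "\<forall>z. z \<bullet> adjoint A (x + y) = z \<bullet> (adjoint A x + adjoint A y)"
        by (simp add: inner_add_right adj)
      then show ?thesis by (simp only: vector_eq_ldot)
    qed
    show "adjoint A (r *\<^sub>R x) = r *\<^sub>R adjoint A x" for r x
    proof -
      have "\<forall>z. z \<bullet> adjoint A (r *\<^sub>R x) = z \<bullet> (r *\<^sub>R adjoint A x)"
        by (simp add: adj)
      then show ?thesis by (simp only: vector_eq_ldot)
    qed
    show "norm (adjoint A x) \<le> norm x * B" for x
    proof -
      have "norm (adjoint A x) * norm (adjoint A x) = A (adjoint A x) \<bullet> x"
        by (simp add: adjoint_inner[OF assms] norm_eq_sqrt_inner)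
      also have "\<dots> \<le> norm (A (adjoint A x)) * norm x" by (rule norm_cauchy_schwarz)
      also have "\<dots> \<le> norm (adjoint A x) * B * norm x" using B by (intro mult_right_mono) auto
      finally have "norm (adjoint A x) * norm (adjoint A x) \<le> norm (adjoint A x) * (norm x * B)"
        by (simp add: ac_simps)
      then show ?thesis using B by (cases "adjoint A x = 0") auto
    qed
  qed
qed

subsection \<open>Weak sequential compactness\<close>

lemma weakly_converges_bounded_linear:
  fixes A :: "'a::{real_inner, banach} \<Rightarrow> 'b::real_inner"
  assumes "bounded_linear A" "weakly_converges X l"
  shows "weakly_converges (\<lambda>n. A (X n)) (A l)"
  using assms by (simp add: weakly_converges_def adjoint_inner)

lemma weakly_converges_subseq:
  "weakly_converges X l \<Longrightarrow> strict_mono r \<Longrightarrow> weakly_converges (X \<circ> r) l"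
  unfolding weakly_converges_def o_def using LIMSEQ_subseq_LIMSEQ[unfolded o_def] by blast

text \<open>Allows weak convergence to be tested on a generating set: convergence against some
  vectors extends to their closed span, the closure being reached by a uniform approximation
  argument that uses the bound \<open>B\<close>.\<close>

lemma bounded_inner_convergent_subspace:
  fixes X :: "nat \<Rightarrow> 'a::real_inner"
  assumes bnd: "\<And>n. norm (X n) \<le> B"
  shows "subspace {z. convergent (\<lambda>n. X n \<bullet> z)}" and "closed {z. convergent (\<lambda>n. X n \<bullet> z)}"
proof -
  let ?W = "{z. convergent (\<lambda>n. X n \<bullet> z)}"
  show "subspace ?W"
    by (auto simp: subspace_def inner_add_right convergent_const intro: convergent_add convergent_mult)
  have "B \<ge> 0" using bnd[of 0] norm_ge_zero order_trans by blast
  show "closed ?W"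
    unfolding closed_sequential_limits
  proof (intro allI impI, elim conjE)
    fix Z z assume Z: "\<forall>k. Z k \<in> ?W" and lim: "Z \<longlonglongrightarrow> z"
    have "Cauchy (\<lambda>n. X n \<bullet> z)"
    proof (rule metric_CauchyI)
      fix e :: real assume "e > 0"
      define \<delta> where "\<delta> = e / (4 * (B + 1))"
      have "\<delta> > 0" using \<open>e > 0\<close> \<open>B \<ge> 0\<close> by (simp add: \<delta>_def)
      then obtain k where k: "norm (Z k - z) < \<delta>"
        using lim unfolding LIMSEQ_iff by blast
      have near: "\<bar>X n \<bullet> Z k - X n \<bullet> z\<bar> \<le> e / 4" for n
      proof -
        have "\<bar>X n \<bullet> (Z k - z)\<bar> \<le> norm (X n) * norm (Z k - z)"
          by (rule Cauchy_Schwarz_ineq2)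
        also have "\<dots> \<le> (B + 1) * \<delta>"
          using k bnd[of n] \<open>B \<ge> 0\<close> by (intro mult_mono) auto
        also have "\<dots> = e / 4" using \<open>B \<ge> 0\<close> by (simp add: \<delta>_def field_simps)
        finally show ?thesis by (simp add: inner_diff_right)
      qed
      have "Cauchy (\<lambda>n. X n \<bullet> Z k)" using Z by (auto intro: convergent_Cauchy)
      then obtain N where N: "\<And>m n. m \<ge> N \<Longrightarrow> n \<ge> N \<Longrightarrow> dist (X m \<bullet> Z k) (X n \<bullet> Z k) < e / 4"
        using metric_CauchyD[of _ "e / 4"] \<open>e > 0\<close> by (metis divide_pos_pos zero_less_numeral)
      have "dist (X m \<bullet> z) (X n \<bullet> z) < e" if "m \<ge> N" "n \<ge> N" for m n
        using N[OF that] near[of m] near[of n] \<open>e > 0\<close> unfolding dist_real_def by linarith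
      then show "\<exists>M. \<forall>m\<ge>M. \<forall>n\<ge>M. dist (X m \<bullet> z) (X n \<bullet> z) < e" by blast
    qed
    then show "z \<in> ?W" by (simp add: Cauchy_convergent)
  qed
qed

text \<open>The space may be non-separable, so the diagonal argument tests the sequence against its
  own terms. Their closed span is all that matters, because a component orthogonal to it has zero
  inner product with every term.\<close>

lemma bounded_weakly_convergent_subseq:
  fixes X :: "nat \<Rightarrow> 'a::{real_inner, banach}"
  assumes bnd: "\<And>n. norm (X n) \<le> B"
  shows "\<exists>r l. strict_mono r \<and> weakly_converges (X \<circ> r) l"
proof -
  interpret subseqs "\<lambda>k s. convergent (\<lambda>n. X (s n) \<bullet> X k)"
  proof
    fix k and s :: "nat \<Rightarrow> nat"
    have "\<bar>X (s n) \<bullet> X k\<bar> \<le> B * norm (X k)" for n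
      using order_trans[OF Cauchy_Schwarz_ineq2 mult_right_mono[OF bnd norm_ge_zero]] by blast
    then have "bounded (range (\<lambda>n. X (s n) \<bullet> X k))"
      unfolding bounded_iff by auto
    then obtain l r where "strict_mono r" "((\<lambda>n. X (s n) \<bullet> X k) \<circ> r) \<longlonglongrightarrow> l"
      using bounded_imp_convergent_subsequence by blast
    then show "\<exists>r'. strict_mono r' \<and> convergent (\<lambda>n. X ((s \<circ> r') n) \<bullet> X k)"
      by (auto simp: convergent_def o_def)
  qed
  define Y where "Y = (\<lambda>n. X (diagseq n))"
  have conv_X: "convergent (\<lambda>n. Y n \<bullet> X k)" for k
  proof -
    \<comment> \<open>Only the tail of the diagonal sequence from \<open>Suc k\<close> on is a
      subsequence of the \<open>k\<close>-th extraction; the finite initial segment is discarded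
      afterwards.\<close>
    have "convergent (\<lambda>n. X ((diagseq \<circ> (+) (Suc k)) n) \<bullet> X k)"
    proof (rule diagseq_holds)
      fix r s :: "nat \<Rightarrow> nat" and n
      assume "strict_mono r" "convergent (\<lambda>m. X (s m) \<bullet> X n)"
      then show "convergent (\<lambda>m. X ((s \<circ> r) m) \<bullet> X n)"
        using convergent_subseq_convergent[of "\<lambda>m. X (s m) \<bullet> X n" r] by (simp add: o_def)
    qed
    then have "convergent (\<lambda>n. Y (n + Suc k) \<bullet> X k)"
      by (simp add: Y_def o_def add.commute)
    then show ?thesis using convergent_ignore_initial_segment[of "\<lambda>n. Y n \<bullet> X k" "Suc k"] by simp
  qed
  define W where "W = {z. convergent (\<lambda>n. Y n \<bullet> z)}"
  have bndY: "norm (Y n) \<le> B" for n by (simp add: Y_def bnd)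
  have W: "subspace W" "closed W"
    unfolding W_def by (rule bounded_inner_convergent_subspace[OF bndY])+
  have conv: "convergent (\<lambda>n. Y n \<bullet> z)" for z
  proof -
    obtain w where w: "w \<in> W" "\<And>u. u \<in> W \<Longrightarrow> (z - w) \<bullet> u = 0"
      using orthogonal_decomposition[OF W(2,1)] by blast
    have "Y n \<in> W" for n unfolding W_def using conv_X by (simp add: Y_def)
    then have "Y n \<bullet> z = Y n \<bullet> w" for n
      using w(2)[of "Y n"] by (simp add: inner_diff_left inner_commute[of "Y n"])
    then show ?thesis using w(1) by (simp add: W_def)
  qed
  define f where "f = (\<lambda>z. lim (\<lambda>n. Y n \<bullet> z))"
  have f: "(\<lambda>n. Y n \<bullet> z) \<longlonglongrightarrow> f z" for z
    using conv unfolding f_def convergent_LIMSEQ_iff .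
  have "bounded_linear f"
  proof (rule bounded_linear_intro[where K = B])
    show "f (x + y) = f x + f y" for x y
      using tendsto_add[OF f f, of x y] f[of "x + y"] by (simp add: inner_add_right LIMSEQ_unique)
    show "f (c *\<^sub>R x) = c *\<^sub>R f x" for c x
      using tendsto_mult_left[OF f, of c x] f[of "c *\<^sub>R x"] by (simp add: LIMSEQ_unique)
    show "norm (f x) \<le> norm x * B" for x
    proof (rule tendsto_upperbound[OF tendsto_norm[OF f]])
      have "norm (Y n \<bullet> x) \<le> norm x * B" for n
        using order_trans[OF Cauchy_Schwarz_ineq2 mult_right_mono[OF bndY norm_ge_zero]]
        by (simp add: mult.commute)
      then show "\<forall>\<^sub>F n in sequentially. norm (Y n \<bullet> x) \<le> norm x * B" by simp
    qed simp
  qed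
  then obtain l where "\<And>z. f z = l \<bullet> z" using riesz_representation by blast
  then have "weakly_converges (X \<circ> diagseq) l"
    using f by (simp add: weakly_converges_def Y_def o_def)
  then show ?thesis using subseq_diagseq by blast
qed

text \<open>If convergence fails against some \<open>z\<close>, a subsequence stays away from the
  limit in that direction; its own weakly convergent subsequence would be a second cluster
  point.\<close>

lemma weakly_converges_if_unique_cluster:
  fixes X :: "nat \<Rightarrow> 'a::{real_inner, banach}"
  assumes bnd: "\<And>n. norm (X n) \<le> B"
    and cluster: "\<And>r m. strict_mono r \<Longrightarrow> weakly_converges (X \<circ> r) m \<Longrightarrow> m = l"
  shows "weakly_converges X l"
proof (rule ccontr)
  assume "\<not> weakly_converges X l"
  then obtain z e where e: "e > 0" and "\<forall>N. \<exists>n\<ge>N. \<not> norm (X n \<bullet> z - l \<bullet> z) < e"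
    unfolding weakly_converges_def LIMSEQ_iff by blast
  then have "infinite {n. \<not> norm (X n \<bullet> z - l \<bullet> z) < e}"
    unfolding infinite_nat_iff_unbounded_le by blast
  then obtain s :: "nat \<Rightarrow> nat" where s: "strict_mono s" "\<And>n. \<not> norm (X (s n) \<bullet> z - l \<bullet> z) < e"
    using infinite_enumerate by blast
  obtain r m where r: "strict_mono r" "weakly_converges ((X \<circ> s) \<circ> r) m"
    using bounded_weakly_convergent_subseq[of "X \<circ> s" B] bnd by auto
  have "strict_mono (s \<circ> r)" "weakly_converges (X \<circ> (s \<circ> r)) m"
    using s(1) r by (simp_all add: strict_mono_o o_assoc)
  then have "m = l" by (rule cluster)
  then have "(\<lambda>n. X (s (r n)) \<bullet> z) \<longlonglongrightarrow> l \<bullet> z"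
    using r(2) by (simp add: weakly_converges_def o_def)
  then show False using s(2) e unfolding LIMSEQ_iff by blast
qed

subsection \<open>Strongly monotone self-adjoint operators\<close>

text \<open>Baire's theorem relative to a closed subset: the cone generated by a constraint set is a
  closed subspace that may have empty interior in the whole space.\<close>

lemma Baire_closed_cover:
  fixes V :: "'a::complete_space set"
  assumes "closed V" "V \<noteq> {}" "\<And>n. closed (C n)" "V \<subseteq> (\<Union>n::nat. C n)"
  shows "\<exists>n. \<exists>x\<in>V. \<exists>e>0. ball x e \<inter> V \<subseteq> C n"
proof -
  interpret M: Metric_space V dist by unfold_locales (auto simp: dist_commute dist_triangle)
  interpret S: Submetric UNIV dist V by unfold_locales auto
  have top: "M.mtopology = top_of_set V"
    using S.mtopology_submetric by simp
  have "M.mcomplete"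
    using assms(1) by (intro S.closedin_mcomplete_imp_mcomplete) (auto simp: complete_UNIV)
  have interior: "M.mtopology interior_of (V \<inter> (\<Union>n. C n)) = V"
    using assms(4) interior_of_topspace[of "top_of_set V"] by (simp add: Int_absorb2 top)
  have "\<exists>n. M.mtopology interior_of (V \<inter> C n) \<noteq> {}"
  proof (rule ccontr)
    assume "\<nexists>n. M.mtopology interior_of (V \<inter> C n) \<noteq> {}"
    then have "M.mtopology interior_of \<Union>(range (\<lambda>n. V \<inter> C n)) = {}"
      using assms(3) top \<open>M.mcomplete\<close>
      by (intro M.metric_Baire_category_alt) (auto simp: closedin_closed_Int)
    moreover have "\<Union>(range (\<lambda>n. V \<inter> C n)) = V \<inter> (\<Union>n. C n)" by auto
    ultimately show False using interior \<open>V \<noteq> {}\<close> by metis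
  qed
  then obtain n x where x: "x \<in> M.mtopology interior_of (V \<inter> C n)" by blast
  then obtain U where U: "openin (top_of_set V) U" "x \<in> U" "U \<subseteq> V \<inter> C n"
    unfolding interior_of_def top by blast
  then obtain e where "e > 0" "ball x e \<inter> V \<subseteq> U"
    unfolding openin_contains_ball by blast
  then show ?thesis using U by blast
qed

text \<open>\<open>\<Sigma>\<close> and \<open>\<Upsilon>\<close> are given only as linear
  self-adjoint maps; their continuity, and that of their inverses, comes from here.\<close>

theorem Hellinger_Toeplitz:
  fixes A :: "'a::{real_inner, banach} \<Rightarrow> 'a"
  assumes "linear A" "self_adjoint A"
  shows "bounded_linear A"
proof -
  interpret linear A by fact
  have sa: "A x \<bullet> y = x \<bullet> A y" for x y using assms(2) by (simp add: self_adjoint_def)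
  \<comment> \<open>This is the set where \<open>norm (A x) \<le> real n\<close>, written through
    the functionals \<open>x \<bullet> A y\<close>. Each is continuous in \<open>x\<close> for fixed
    \<open>y\<close>, so closedness is visible before continuity of \<open>A\<close> is
    known.\<close>
  define C where "C n = (\<Inter>y\<in>cball 0 1. {x. \<bar>x \<bullet> A y\<bar> \<le> real n})" for n
  have C_eq: "x \<in> C n \<longleftrightarrow> norm (A x) \<le> real n" for x n
  proof
    assume x: "x \<in> C n"
    have "A x \<bullet> sgn (A x) = norm (A x)"
      by (cases "A x = 0") (simp_all add: sgn_div_norm dot_square_norm power2_eq_square)
    moreover have "\<bar>x \<bullet> A (sgn (A x))\<bar> \<le> real n"
      using x by (auto simp: C_def norm_sgn)
    ultimately show "norm (A x) \<le> real n" by (simp add: sa[symmetric])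
  next
    assume le: "norm (A x) \<le> real n"
    have "\<bar>x \<bullet> A y\<bar> \<le> real n" if "norm y \<le> 1" for y
    proof -
      have "\<bar>A x \<bullet> y\<bar> \<le> norm (A x) * norm y" by (rule Cauchy_Schwarz_ineq2)
      also have "\<dots> \<le> real n * 1" using le that by (intro mult_mono) auto
      finally show ?thesis by (simp add: sa)
    qed
    then show "x \<in> C n" by (simp add: C_def)
  qed
  have "closed (C n)" for n
    unfolding C_def by (intro closed_INT ballI closed_Collect_le continuous_intros)
  moreover have "UNIV \<subseteq> (\<Union>n. C n)"
    using real_arch_simple by (auto simp: C_eq)
  ultimately obtain n a e where e: "e > 0" "ball a e \<subseteq> C n"
    using Baire_closed_cover[of UNIV C] by auto
  show ?thesis
  proof (rule bounded_linear_intro[where K = "4 * real n / e"])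
    fix x
    show "norm (A x) \<le> norm x * (4 * real n / e)"
    proof (cases "x = 0")
      case False
      define t where "t = e / (2 * norm x)"
      have t: "t > 0" using e False by (simp add: t_def)
      have "a \<in> C n" "a + t *\<^sub>R x \<in> C n"
        using e False by (auto simp: t_def dist_norm intro!: subsetD[OF e(2)])
      then have "norm (A (a + t *\<^sub>R x) - A a) \<le> real n + real n"
        using order_trans[OF norm_triangle_ineq4 add_mono] by (simp only: C_eq)
      then have "t * norm (A x) \<le> 2 * real n" using t by (simp add: add scale)
      then show ?thesis using e False by (simp add: t_def field_simps)
    qed simp
  qed (simp_all add: add scale)
qed

text \<open>The Lax-Milgram argument: the lower bound
  \<open>\<beta> * norm x \<le> norm (A x)\<close> gives injectivity and a closed range, and a
  vector orthogonal to the range vanishes when tested against its own image.\<close>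

lemma strongly_monotone_bij:
  fixes A :: "'a::{real_inner, banach} \<Rightarrow> 'a"
  assumes "linear A" "self_adjoint A" "strongly_monotone A"
  shows "bij A"
proof -
  interpret bounded_linear A by (rule Hellinger_Toeplitz[OF assms(1,2)])
  obtain \<beta> where \<beta>: "\<beta> > 0" "\<And>x. \<beta> * (norm x)\<^sup>2 \<le> x \<bullet> A x"
    using assms(3) by (auto simp: strongly_monotone_def)
  have bound: "\<beta> * norm x \<le> norm (A x)" for x
  proof (cases "x = 0")
    case False
    have "norm x * (\<beta> * norm x) \<le> norm x * norm (A x)"
      using order_trans[OF \<beta>(2)[of x] norm_cauchy_schwarz] by (simp add: power2_eq_square ac_simps)
    then show ?thesis using False by simp
  qed simp
  have "inj A"
  proof (rule injI)
    fix x y assume "A x = A y"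
    then have "\<beta> * norm (x - y) \<le> 0" using bound[of "x - y"] by (simp add: diff)
    then show "x = y" using \<beta>(1) by (simp add: mult_le_0_iff)
  qed
  have "closed (range A)"
    unfolding closed_sequential_limits
  proof (intro allI impI, elim conjE)
    fix Y l assume "\<forall>n. Y n \<in> range A" and lim: "Y \<longlonglongrightarrow> l"
    then have "\<forall>n. \<exists>x. Y n = A x" by blast
    from choice[OF this] obtain X where X: "\<And>n. Y n = A (X n)" by blast
    have "Cauchy X"
    proof (rule metric_CauchyI)
      fix e :: real assume "e > 0"
      then have "\<beta> * e > 0" using \<beta>(1) by simp
      then obtain N where N: "\<And>m n. m \<ge> N \<Longrightarrow> n \<ge> N \<Longrightarrow> dist (Y m) (Y n) < \<beta> * e"
        using metric_CauchyD[OF LIMSEQ_imp_Cauchy[OF lim]] by blast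
      have "dist (X m) (X n) < e" if "m \<ge> N" "n \<ge> N" for m n
      proof -
        have "\<beta> * dist (X m) (X n) < \<beta> * e"
          using N[OF that] bound[of "X m - X n"] by (simp add: X dist_norm diff)
        then show ?thesis using \<beta>(1) by simp
      qed
      then show "\<exists>M. \<forall>m\<ge>M. \<forall>n\<ge>M. dist (X m) (X n) < e" by blast
    qed
    then obtain x where "X \<longlonglongrightarrow> x" using Cauchy_convergent_iff convergent_def by blast
    then have "Y \<longlonglongrightarrow> A x" unfolding X by (rule tendsto)
    then show "l \<in> range A" using lim LIMSEQ_unique by blast
  qed
  moreover have "subspace (range A)"
    by (intro linear_subspace_image subspace_UNIV assms(1))
  ultimately have decomp: "\<exists>z\<in>range A. \<forall>u\<in>range A. (x - z) \<bullet> u = 0" for x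
    by (rule orthogonal_decomposition)
  have "x \<in> range A" for x
  proof -
    obtain z where z: "z \<in> range A" "\<And>u. (x - z) \<bullet> A u = 0" using decomp[of x] by auto
    have "\<beta> * (norm (x - z))\<^sup>2 \<le> 0" using \<beta>(2)[of "x - z"] z(2)[of "x - z"] by simp
    then have "x = z" using \<beta>(1) by (simp add: mult_le_0_iff)
    then show ?thesis using z(1) by simp
  qed
  then show ?thesis using \<open>inj A\<close> by (auto simp: bij_def)
qed

lemma strongly_monotone_inverse:
  fixes A :: "'a::{real_inner, banach} \<Rightarrow> 'a"
  assumes "linear A" "self_adjoint A" "strongly_monotone A"
  shows "A (inv A x) = x" "inv A (A x) = x" "linear (inv A)" "self_adjoint (inv A)"
    "bounded_linear (inv A)" "strongly_monotone (inv A)"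
proof -
  interpret A: bounded_linear A by (rule Hellinger_Toeplitz[OF assms(1,2)])
  have bij: "bij A" by (rule strongly_monotone_bij[OF assms])
  show right: "A (inv A x) = x" for x using bij by (simp add: bij_def surj_f_inv_f)
  show left: "inv A (A x) = x" for x using bij by (simp add: bij_def)
  show lin: "linear (inv A)"
  proof (rule linearI)
    show "inv A (x + y) = inv A x + inv A y" for x y
      by (metis A.add left right)
    show "inv A (c *\<^sub>R x) = c *\<^sub>R inv A x" for c x
      by (metis A.scaleR left right)
  qed
  show sa: "self_adjoint (inv A)"
    using assms(2) right unfolding self_adjoint_def by metis
  show "bounded_linear (inv A)" by (rule Hellinger_Toeplitz[OF lin sa])
  obtain \<beta> where \<beta>: "\<beta> > 0" "\<And>x. \<beta> * (norm x)\<^sup>2 \<le> x \<bullet> A x"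
    using assms(3) by (auto simp: strongly_monotone_def)
  obtain B where B: "B > 0" "\<And>x. norm (A x) \<le> norm x * B" using A.pos_bounded by blast
  \<comment> \<open>The constant combines strong monotonicity of \<open>A\<close> at
    \<open>inv A x\<close> with \<open>norm x \<le> norm (inv A x) * B\<close>.\<close>
  have "(\<beta> / B\<^sup>2) * (norm x)\<^sup>2 \<le> x \<bullet> inv A x" for x
  proof -
    have "(norm x)\<^sup>2 \<le> (norm (inv A x) * B)\<^sup>2"
      using B(2)[of "inv A x"] right by (intro power_mono) auto
    then have "(\<beta> / B\<^sup>2) * (norm x)\<^sup>2 \<le> \<beta> * (norm (inv A x))\<^sup>2"
      using B(1) \<beta>(1) by (simp add: field_simps power_mult_distrib)
    also have "\<dots> \<le> inv A x \<bullet> A (inv A x)" by (rule \<beta>(2))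
    finally show ?thesis by (simp add: right inner_commute)
  qed
  moreover have "\<beta> / B\<^sup>2 > 0" using B(1) \<beta>(1) by simp
  ultimately show "strongly_monotone (inv A)" unfolding strongly_monotone_def by blast
qed

subsection \<open>Conjugates and subgradients\<close>

text \<open>Heights are real, so the epigraph lives in the Hilbert space
  \<open>'a \<times> real\<close>, where projection and separation apply to it directly.\<close>

definition epi :: "('a \<Rightarrow> ereal) \<Rightarrow> ('a \<times> real) set" where
  "epi f = {(x, t). f x \<le> ereal t}"

lemma mem_epi [simp]: "(x, t) \<in> epi f \<longleftrightarrow> f x \<le> ereal t"
  by (simp add: epi_def)

lemma fst_epi: "fst ` epi f = edom f"
proof (intro set_eqI iffI)
  fix x assume "x \<in> edom f"
  then obtain t where "f x \<le> ereal t"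
    by (cases "f x") (auto simp: edom_def)
  then have "(x, t) \<in> epi f" by simp
  then show "x \<in> fst ` epi f" by (metis fst_conv imageI)
qed (auto simp: edom_def intro: order_le_less_trans)

lemma closed_epi:
  fixes f :: "'a::metric_space \<Rightarrow> ereal"
  assumes "lower_semicontinuous f"
  shows "closed (epi f)"
  unfolding closed_sequential_limits
proof (intro allI impI, elim conjE)
  fix P p assume P: "\<forall>n. P n \<in> epi f" and lim: "P \<longlonglongrightarrow> p"
  obtain x t where p: "p = (x, t)" by (cases p)
  have lims: "(\<lambda>n. fst (P n)) \<longlonglongrightarrow> x" "(\<lambda>n. ereal (snd (P n))) \<longlonglongrightarrow> ereal t"
    using tendsto_fst[OF lim] tendsto_snd[OF lim] by (auto simp: p)
  have "f x \<le> ereal t"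
  proof (rule ccontr)
    assume "\<not> f x \<le> ereal t"
    then have "ereal t < f x" by simp
    from dense[OF this] obtain y where y: "ereal t < y" "y < f x" by blast
    have "f x \<le> Liminf (nhds x) f" using assms by (simp add: lower_semicontinuous_def)
    then have "eventually (\<lambda>z. y < f z) (nhds x)" using y(2) by (simp add: le_Liminf_iff)
    then have "eventually (\<lambda>n. y < f (fst (P n))) sequentially"
      using lims(1) by (rule eventually_compose_filterlim)
    moreover have "eventually (\<lambda>n. ereal (snd (P n)) < y) sequentially"
      using order_tendstoD(2)[OF lims(2) y(1)] .
    ultimately have "eventually (\<lambda>n. False) sequentially"
    proof eventually_elim
      case (elim n)
      have "f (fst (P n)) \<le> ereal (snd (P n))"
        using P[rule_format, of n] by (cases "P n") simp
      with elim show False by simp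
    qed
    then show False by simp
  qed
  then show "p \<in> epi f" by (simp add: p)
qed

lemma convex_epi:
  assumes "convex_function f"
  shows "convex (epi f)"
  unfolding convex_alt
proof (intro ballI allI impI, elim conjE)
  fix p q :: "'a \<times> real" and u :: real
  assume "p \<in> epi f" "q \<in> epi f" "0 \<le> u" "u \<le> 1"
  obtain x s y t where pq: "p = (x, s)" "q = (y, t)" by (cases p, cases q)
  have le: "f x \<le> ereal s" "f y \<le> ereal t" using \<open>p \<in> epi f\<close> \<open>q \<in> epi f\<close> by (auto simp: pq)
  have "f ((1 - u) *\<^sub>R x + u *\<^sub>R y) \<le> ereal ((1 - u) * s + u * t)"
  proof (cases "u = 0 \<or> u = 1")
    case True then show ?thesis using le by auto
  next
    case False
    then have "u \<in> {0<..<1}" using \<open>0 \<le> u\<close> \<open>u \<le> 1\<close> by auto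
    then have "f ((1 - u) *\<^sub>R x + u *\<^sub>R y) \<le> ereal (1 - u) * f x + ereal u * f y"
      using assms by (simp add: convex_function_def)
    also have "\<dots> \<le> ereal (1 - u) * ereal s + ereal u * ereal t"
      using le \<open>0 \<le> u\<close> \<open>u \<le> 1\<close> by (intro add_mono ereal_mult_left_mono) auto
    finally show ?thesis by simp
  qed
  then show "(1 - u) *\<^sub>R p + u *\<^sub>R q \<in> epi f" by (simp add: pq)
qed

lemma Gamma0_epi:
  assumes "g \<in> Gamma0"
  shows "closed (epi g)" "convex (epi g)" "epi g \<noteq> {}" "g x \<noteq> -\<infinity>"
  using assms closed_epi convex_epi fst_epi[of g] by (auto simp: Gamma0_def proper_def)

text \<open>Reads a point \<open>(u, c)\<close> of the conjugate's epigraph as an affine minorant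
  \<open>y \<bullet> u - c\<close> of \<open>g\<close>, in purely real inequalities. Where
  \<open>g\<close> takes the value minus infinity both sides are false.\<close>

lemma fenchel_conjugate_le_iff:
  "fenchel_conjugate g u \<le> ereal c \<longleftrightarrow> (\<forall>y t. g y \<le> ereal t \<longrightarrow> y \<bullet> u - c \<le> t)"
proof -
  have "ereal (y \<bullet> u) - g y \<le> ereal c \<longleftrightarrow> (\<forall>t. g y \<le> ereal t \<longrightarrow> y \<bullet> u - c \<le> t)" for y
  proof (cases "g y")
    case (real r)
    then show ?thesis by (auto simp: algebra_simps)
  next
    case MInf
    have "\<not> (\<forall>t. y \<bullet> u - c \<le> t)"
      by (metis less_add_one add_diff_cancel_right' diff_add_cancel not_le)
    then show ?thesis using MInf by simp
  qed simp
  then show ?thesis by (auto simp: fenchel_conjugate_def SUP_le_iff)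
qed

text \<open>Each point \<open>(y, t)\<close> of \<open>epi g\<close> contributes the closed
  half-space of pairs \<open>(u, c)\<close> with \<open>y \<bullet> u - c \<le> t\<close>; the
  epigraph of the conjugate is their intersection.\<close>

lemma epi_fenchel_conjugate:
  "closed (epi (fenchel_conjugate g))" "convex (epi (fenchel_conjugate g))"
proof -
  have eq: "epi (fenchel_conjugate g) = (\<Inter>(y, t)\<in>epi g. {p. (y, -1) \<bullet> p \<le> t})"
    by (auto simp: epi_def fenchel_conjugate_le_iff inner_prod_def algebra_simps)
  show "closed (epi (fenchel_conjugate g))"
    unfolding eq by (auto intro!: closed_INT closed_halfspace_le)
  show "convex (epi (fenchel_conjugate g))"
    unfolding eq by (auto intro!: convex_INT convex_halfspace_le)
qed

text \<open>Real-valued form: a subgradient exists only where \<open>f\<close> is finite, and \<open>f\<close> then omits \<open>-\<infinity>\<close>.\<close>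

definition is_subgradient :: "('a::real_inner \<Rightarrow> ereal) \<Rightarrow> 'a \<Rightarrow> 'a \<Rightarrow> bool" where
  "is_subgradient f x u \<longleftrightarrow>
     (\<exists>r. f x = ereal r \<and> (\<forall>y t. f y \<le> ereal t \<longrightarrow> r + (y - x) \<bullet> u \<le> t))"

text \<open>The equality case of the Fenchel-Young inequality.\<close>

lemma fenchel_conjugate_subgradient:
  assumes "is_subgradient g p u" and r: "g p = ereal r"
  shows "fenchel_conjugate g u = ereal (p \<bullet> u - r)"
proof (rule antisym)
  show "fenchel_conjugate g u \<le> ereal (p \<bullet> u - r)"
    using assms by (auto simp: fenchel_conjugate_le_iff is_subgradient_def inner_diff_left algebra_simps)
  have "ereal (p \<bullet> u) - g p \<le> fenchel_conjugate g u"
    unfolding fenchel_conjugate_def by (rule SUP_upper) simp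
  then show "ereal (p \<bullet> u - r) \<le> fenchel_conjugate g u" by (simp add: r)
qed

lemma is_subgradient_monotone:
  assumes "is_subgradient f x u" "is_subgradient f y v"
  shows "(x - y) \<bullet> (u - v) \<ge> 0"
proof -
  obtain r s where "f x = ereal r" "f y = ereal s" "r + (y - x) \<bullet> u \<le> s" "s + (x - y) \<bullet> v \<le> r"
    using assms unfolding is_subgradient_def by (metis order_refl)
  then show ?thesis by (simp add: inner_diff_left inner_diff_right)
qed

text \<open>The core of the Fenchel-Moreau theorem, obtained by projecting \<open>(p, r)\<close>
  onto the epigraph. The initial minorant serves the case where \<open>p\<close> lies outside the
  domain and the separating hyperplane is vertical.\<close>

lemma affine_minorant_above:
  fixes g :: "'a::{real_inner, banach} \<Rightarrow> ereal"
  assumes g: "g \<in> Gamma0"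
    and minorant: "\<And>y t. g y \<le> ereal t \<Longrightarrow> y \<bullet> u0 - c0 \<le> t"
    and r: "ereal r < g p"
  shows "\<exists>u c. (\<forall>y t. g y \<le> ereal t \<longrightarrow> y \<bullet> u - c \<le> t) \<and> r < p \<bullet> u - c"
proof -
  obtain q where q: "q \<in> epi g" "\<And>e. e \<in> epi g \<Longrightarrow> ((p, r) - q) \<bullet> (e - q) \<le> 0"
    using hilbert_projection[OF Gamma0_epi(1,2,3)[OF g]] by blast
  obtain z \<rho> where z: "q = (z, \<rho>)" by (cases q)
  have sep: "(p - z) \<bullet> (y - z) + (r - \<rho>) * (t - \<rho>) \<le> 0" if "g y \<le> ereal t" for y t
    using q(2)[of "(y, t)"] that by (simp add: z inner_prod_def)
  have gz: "g z \<le> ereal \<rho>" using q(1) by (simp add: z)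
  \<comment> \<open>The point straight above the projection, one unit higher, is also in the
    epigraph; testing with it shows that the normal does not point upwards.\<close>
  then have "g z \<le> ereal (\<rho> + 1)" by (rule order_trans) simp
  from sep[OF this] have "r \<le> \<rho>" by simp
  show ?thesis
  proof (cases "r < \<rho>")
    case True
    define u where "u = (1 / (\<rho> - r)) *\<^sub>R (p - z)"
    have u: "w \<bullet> u = ((p - z) \<bullet> w) / (\<rho> - r)" for w by (simp add: u_def inner_commute)
    have "y \<bullet> u - (z \<bullet> u - \<rho>) \<le> t" if "g y \<le> ereal t" for y t
    proof -
      have "(p - z) \<bullet> (y - z) / (\<rho> - r) \<le> t - \<rho>"
      proof -
        have "(r - \<rho>) * (t - \<rho>) = - ((t - \<rho>) * (\<rho> - r))" by (simp add: algebra_simps)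
        with sep[OF that] have "(p - z) \<bullet> (y - z) \<le> (t - \<rho>) * (\<rho> - r)" by linarith
        then show ?thesis using True by (simp only: pos_divide_le_eq diff_gt_0_iff_gt)
      qed
      then show ?thesis by (simp add: u inner_diff_right diff_divide_distrib)
    qed
    moreover have "r < p \<bullet> u - (z \<bullet> u - \<rho>)"
    proof -
      have "0 \<le> (p - z) \<bullet> (p - z) / (\<rho> - r)" using True by simp
      then have "0 \<le> p \<bullet> u - z \<bullet> u" by (simp add: u inner_diff_right diff_divide_distrib)
      then show ?thesis using True by linarith
    qed
    ultimately show ?thesis by blast
  next
    case False
    \<comment> \<open>The separating hyperplane is vertical; tilt the given minorant by a large multiple of it.\<close>
    then have "\<rho> = r" using \<open>r \<le> \<rho>\<close> by simp
    then have "z \<noteq> p" using gz r by auto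
    define d where "d = (p - z) \<bullet> (p - z)"
    have "d > 0" using \<open>z \<noteq> p\<close> by (simp add: d_def)
    \<comment> \<open>The tilt gains \<open>k * d\<close> at \<open>p\<close>, which exceeds the gap
      between \<open>r\<close> and the value of the old minorant there by at least one.\<close>
    define k where "k = (\<bar>r - (p \<bullet> u0 - c0)\<bar> + 1) / d"
    have k: "k > 0" "k * d = \<bar>r - (p \<bullet> u0 - c0)\<bar> + 1" using \<open>d > 0\<close> by (auto simp: k_def)
    define u c where "u = u0 + k *\<^sub>R (p - z)" and "c = c0 + k * (z \<bullet> (p - z))"
    have uc: "y \<bullet> u - c = (y \<bullet> u0 - c0) + k * ((p - z) \<bullet> (y - z))" for y
      unfolding u_def c_def
      by (simp add: inner_add_right inner_diff_left inner_diff_right inner_commute algebra_simps)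
    have "y \<bullet> u - c \<le> t" if "g y \<le> ereal t" for y t
    proof -
      have "k * ((p - z) \<bullet> (y - z)) \<le> 0"
        using sep[OF that] k(1) \<open>\<rho> = r\<close> by (simp add: mult_le_0_iff)
      then show ?thesis using minorant[OF that] by (simp add: uc)
    qed
    moreover have "r < p \<bullet> u - c" using k(2) by (simp add: uc flip: d_def)
    ultimately show ?thesis by blast
  qed
qed

text \<open>If \<open>g p\<close> exceeded \<open>p \<bullet> u - c\<close>, an affine minorant
  passing above that value at \<open>p\<close> would be a point of the conjugate's epigraph
  violating the subgradient inequality. So Fenchel-Young holds with equality at
  \<open>p\<close>.\<close>

lemma is_subgradient_of_conjugate:
  fixes g :: "'a::{real_inner, banach} \<Rightarrow> ereal"
  assumes g: "g \<in> Gamma0" and sub: "is_subgradient (fenchel_conjugate g) u p"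
  shows "is_subgradient g p u"
proof -
  obtain c where c: "fenchel_conjugate g u = ereal c"
    and sub_c: "\<And>w d. fenchel_conjugate g w \<le> ereal d \<Longrightarrow> c + (w - u) \<bullet> p \<le> d"
    using sub by (auto simp: is_subgradient_def)
  have minorant: "y \<bullet> u - c \<le> t" if "g y \<le> ereal t" for y t
    using c fenchel_conjugate_le_iff[of g u c] that by auto
  have "g p \<le> ereal (p \<bullet> u - c)"
  proof (rule ccontr)
    assume "\<not> ?thesis"
    then have above: "ereal (p \<bullet> u - c) < g p" by simp
    obtain w d where "fenchel_conjugate g w \<le> ereal d" "p \<bullet> u - c < p \<bullet> w - d"
      using affine_minorant_above[OF g minorant above] unfolding fenchel_conjugate_le_iff by blast
    with sub_c[of w d] show False by (simp add: inner_diff_right inner_commute[of _ p])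
  qed
  moreover obtain r where r: "g p = ereal r"
    using calculation Gamma0_epi(4)[OF g] by (cases "g p") auto
  ultimately have "r = p \<bullet> u - c" using minorant[of p r] by simp
  then have "r + (y - p) \<bullet> u \<le> t" if "g y \<le> ereal t" for y t
    using minorant[OF that] by (simp add: inner_diff_left)
  then show ?thesis using r by (auto simp: is_subgradient_def)
qed

subsection \<open>Constraint qualification and multipliers\<close>

text \<open>The successive approximation of the open mapping theorem, which removes the closure.
  With \<open>D\<close> only convex, the corrections must be summed with weights 1/2, 1/4, ... of
  total mass one, and this is the origin of the factor 1/2.\<close>

lemma dense_image_halving:
  fixes D :: "'a::banach set" and A :: "'a \<Rightarrow> 'b::real_normed_vector"
  assumes A: "bounded_linear A" and D: "closed D" "convex D" "\<And>d. d \<in> D \<Longrightarrow> norm d \<le> N"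
    and V: "subspace V" "A ` D \<subseteq> V"
    and dense: "\<And>w. w \<in> V \<Longrightarrow> norm w < \<rho> \<Longrightarrow> w \<in> closure (A ` D)"
    and w: "w \<in> V" "norm w < \<rho>"
  shows "\<exists>d\<in>D. A d = (1/2) *\<^sub>R w"
proof -
  interpret A: bounded_linear A by fact
  have "\<rho> > 0" using w(2) norm_ge_zero[of w] by linarith
  have "\<exists>d\<in>D. norm (u - A d) < \<rho> / 2" if u: "u \<in> V" "norm u < \<rho>" for u
  proof -
    obtain c where "c \<in> A ` D" "dist c u < \<rho> / 2"
      using dense[OF u] half_gt_zero[OF \<open>\<rho> > 0\<close>] unfolding closure_approachable by blast
    then show ?thesis by (auto simp: dist_norm norm_minus_commute)
  qed
  then obtain c where c: "\<And>u. u \<in> V \<Longrightarrow> norm u < \<rho> \<Longrightarrow> c u \<in> D \<and> norm (u - A (c u)) < \<rho> / 2"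
    by metis
  \<comment> \<open>The residual is doubled after each correction, so it stays in the same ball of
    radius \<open>\<rho>\<close> and \<open>c\<close> applies again.\<close>
  define r where "r = rec_nat w (\<lambda>_ u. 2 *\<^sub>R (u - A (c u)))"
  have r0: "r 0 = w" and rSuc: "r (Suc k) = 2 *\<^sub>R (r k - A (c (r k)))" for k
    by (simp_all add: r_def)
  have r: "r k \<in> V \<and> norm (r k) < \<rho>" for k
  proof (induction k)
    case (Suc k)
    then have "c (r k) \<in> D" "norm (r k - A (c (r k))) < \<rho> / 2" using c by auto
    then show ?case
      using Suc V by (auto simp: rSuc intro!: subspace_scale subspace_diff)
  qed (simp add: r0 w)
  define b where "b k = c (r k)" for k
  have b: "b k \<in> D" for k using r c by (simp add: b_def)
  define S where "S k = (\<Sum>j<k. (1/2) ^ Suc j *\<^sub>R b j)" for k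
  have AS: "(1/2) *\<^sub>R w = A (S k) + (1/2) ^ Suc k *\<^sub>R r k" for k
  proof (induction k)
    case (Suc k)
    have "(1/2) ^ Suc (Suc k) *\<^sub>R r (Suc k) = (1/2) ^ Suc k *\<^sub>R (r k - A (b k))"
      by (simp add: rSuc b_def)
    then show ?case unfolding Suc.IH by (simp add: S_def A.add A.scaleR scaleR_diff_right)
  qed (simp add: S_def r0 A.zero)
  \<comment> \<open>The weights in \<open>S k\<close> add up to \<open>1 - (1/2) ^ k\<close>; giving
    the missing mass to an arbitrary point of \<open>D\<close> makes a true convex
    combination.\<close>
  have SD: "S k + (1/2) ^ k *\<^sub>R d \<in> D" if "d \<in> D" for k d
    using that
  proof (induction k arbitrary: d)
    case (Suc k)
    have "(1/2) *\<^sub>R b k + (1/2) *\<^sub>R d \<in> D" using D(2) b Suc.prems by (intro convexD) auto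
    from Suc.IH[OF this] show ?case by (simp add: S_def scaleR_add_right add.assoc)
  qed (simp add: S_def)
  have geo: "(\<lambda>k. (1/2::real) ^ k) \<longlonglongrightarrow> 0" by (rule LIMSEQ_power_zero) simp
  have "summable (\<lambda>j. (1/2) ^ Suc j *\<^sub>R b j)"
  proof (rule summable_norm_cancel, rule summable_comparison_test')
    show "summable (\<lambda>j. (1/2::real) ^ j * N)" by (intro summable_mult2 summable_geometric) simp
    show "norm (norm ((1/2) ^ Suc j *\<^sub>R b j)) \<le> (1/2) ^ j * N" if "j \<ge> 0" for j
    proof -
      have "(1/2::real) ^ Suc j * norm (b j) \<le> (1/2) ^ j * N"
        using D(3)[OF b] by (intro mult_mono) auto
      then show ?thesis by simp
    qed
  qed
  then obtain s where s: "S \<longlonglongrightarrow> s"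
    unfolding summable_def sums_def S_def by blast
  have "(\<lambda>k. S k + (1/2) ^ k *\<^sub>R b 0) \<longlonglongrightarrow> s + 0 *\<^sub>R b 0"
    by (intro tendsto_add tendsto_scaleR s geo tendsto_const)
  then have "s + 0 *\<^sub>R b 0 \<in> D"
    by (rule closed_sequentially[OF D(1), rotated]) (rule SD[OF b])
  then have "s \<in> D" by simp
  have "(\<lambda>k. (1/2) ^ Suc k *\<^sub>R r k) \<longlonglongrightarrow> 0"
  proof (rule Lim_null_comparison)
    show "\<forall>\<^sub>F k in sequentially. norm ((1/2) ^ Suc k *\<^sub>R r k) \<le> (1/2) ^ Suc k * \<rho>"
      using r by (intro always_eventually allI) (simp add: less_imp_le)
    show "(\<lambda>k. (1/2) ^ Suc k * \<rho>) \<longlonglongrightarrow> 0"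
      using tendsto_mult_right[OF LIMSEQ_Suc[OF geo], of \<rho>] by simp
  qed
  then have "(\<lambda>k. A (S k) + (1/2) ^ Suc k *\<^sub>R r k) \<longlonglongrightarrow> A s + 0"
    by (intro tendsto_add A.tendsto s)
  then have "A s = (1/2) *\<^sub>R w"
    unfolding AS[symmetric] by (simp add: LIMSEQ_const_iff)
  with \<open>s \<in> D\<close> show ?thesis by blast
qed

text \<open>An open mapping theorem for a closed convex set: the linear map is open at 0 relative to
  the generated subspace, with preimages bounded uniformly by \<open>N\<close>. That bound is what
  later controls a linear functional on the preimages.\<close>

theorem Robinson_Ursescu:
  fixes D :: "'a::banach set" and A :: "'a \<Rightarrow> 'b::banach"
  assumes A: "bounded_linear A" and D: "closed D" "convex D"
    and sri: "0 \<in> sri (A ` D)"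
  shows "\<exists>\<delta>>0. \<exists>N. \<forall>w\<in>cone hull (A ` D). norm w < \<delta> \<longrightarrow> (\<exists>d\<in>D. norm d \<le> N \<and> A d = w)"
proof -
  interpret A: bounded_linear A by fact
  define V where "V = cone hull (A ` D)"
  have V: "closed V" "subspace V" and "0 \<in> A ` D"
    using sri by (auto simp: sri_def V_def)
  have AV: "A ` D \<subseteq> V" unfolding V_def by (rule hull_subset)
  obtain d0 where d0: "d0 \<in> D" "A d0 = 0" using \<open>0 \<in> A ` D\<close> by auto
  define B where "B n = D \<inter> cball 0 (real n)" for n
  have B: "closed (B n)" "convex (B n)" for n
    unfolding B_def using D by (auto intro: convex_Int)
  have B_mono: "A ` B m \<subseteq> A ` B n" if "m \<le> n" for m n using that by (auto simp: B_def)
  \<comment> \<open>Mixing with the zero-image point \<open>d0\<close> absorbs the factor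
    \<open>t\<close> of the cone, so that the scaling and the norm bound can share a single
    integer.\<close>
  have scaled: "\<exists>n. \<exists>a\<in>A ` B (Suc n). w = real (Suc n) *\<^sub>R a" if "w \<in> V" for w
  proof -
    obtain t d where w: "w = t *\<^sub>R A d" "t \<ge> 0" "d \<in> D"
      using \<open>w \<in> V\<close> by (auto simp: V_def cone_hull_expl)
    obtain n where n: "max t (max (norm d) (norm d0)) \<le> real n" using real_arch_simple by blast
    define s where "s = t / real (Suc n)"
    have s: "0 \<le> s" "s \<le> 1" "real (Suc n) * s = t" using n w(2) by (auto simp: s_def)
    have "s *\<^sub>R d + (1 - s) *\<^sub>R d0 \<in> D \<inter> cball 0 (real (Suc n))"
      using s n w(3) d0(1) by (intro convexD[OF convex_Int] D convex_cball) auto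
    moreover have "w = real (Suc n) *\<^sub>R A (s *\<^sub>R d + (1 - s) *\<^sub>R d0)"
      using s(3) by (simp add: A.add A.scaleR d0 w(1) del: of_nat_Suc)
    ultimately show ?thesis unfolding B_def by blast
  qed
  define C where "C n = (\<lambda>a. real (Suc n) *\<^sub>R a) ` closure (A ` B (Suc n))" for n
  have "closed (C n)" for n unfolding C_def by (intro closed_scaling closed_closure)
  moreover have "V \<subseteq> (\<Union>n. C n)"
    using scaled closure_subset by (fastforce simp: C_def)
  moreover have "V \<noteq> {}" using V(2) subspace_0 by blast
  ultimately obtain n x e where x: "x \<in> V" "e > 0" "ball x e \<inter> V \<subseteq> C n"
    using Baire_closed_cover[OF V(1)] by metis
  \<comment> \<open>Since the cone is a subspace, the opposite of the centre is reachable too;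
    adding it moves the ball given by Baire's theorem to the origin.\<close>
  have "- x \<in> V" using x(1) V(2) by (rule subspace_neg[rotated])
  then obtain k a where a: "a \<in> A ` B (Suc k)" "- x = real (Suc k) *\<^sub>R a" using scaled by blast
  define N where "N = max (Suc n) (Suc k)"
  \<comment> \<open>The sum of the two scalings, so that dividing by it turns the recentring into a
    convex combination.\<close>
  define m where "m = real (Suc n) + real (Suc k)"
  have "m > 0" by (simp add: m_def)
  have aN: "a \<in> closure (A ` B N)"
    by (rule subsetD[OF closure_subset subsetD[OF B_mono a(1)]]) (simp add: N_def)
  have dense: "w \<in> closure (A ` B N)" if w: "w \<in> V" "norm w < e / m" for w
  proof -
    have "m * norm w < e" using w(2) \<open>m > 0\<close> by (simp add: pos_less_divide_eq mult.commute)
    moreover have "x + m *\<^sub>R w \<in> V" by (intro subspace_add subspace_scale V(2) x(1) w(1))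
    ultimately have "x + m *\<^sub>R w \<in> ball x e \<inter> V" using \<open>m > 0\<close> by (simp add: dist_norm)
    then obtain c where c: "c \<in> closure (A ` B (Suc n))" "x + m *\<^sub>R w = real (Suc n) *\<^sub>R c"
      using x(3) by (auto simp: C_def)
    have cN: "c \<in> closure (A ` B N)"
      using c(1) closure_mono[OF B_mono[of "Suc n" N]] by (auto simp: N_def)
    have eq: "m *\<^sub>R w = real (Suc n) *\<^sub>R c + real (Suc k) *\<^sub>R a"
      unfolding c(2)[symmetric] a(2)[symmetric] by simp
    have "w = (1 / m) *\<^sub>R (m *\<^sub>R w)" using \<open>m > 0\<close> by simp
    also have "\<dots> = (real (Suc n) / m) *\<^sub>R c + (real (Suc k) / m) *\<^sub>R a"
      unfolding eq by (simp add: scaleR_add_right del: of_nat_Suc)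
    also have "\<dots> \<in> closure (A ` B N)"
    proof (rule convexD)
      show "convex (closure (A ` B N))"
        by (intro convex_closure convex_linear_image A.linear_axioms B)
      show "real (Suc n) / m + real (Suc k) / m = 1"
        using \<open>m > 0\<close> by (simp add: m_def flip: add_divide_distrib)
    qed (use cN aN \<open>m > 0\<close> in auto)
    finally show ?thesis .
  qed
  have "\<exists>d\<in>D. norm d \<le> real N \<and> A d = w" if w: "w \<in> V" "norm w < e / m / 2" for w
  proof -
    have "\<exists>d\<in>B N. A d = (1/2) *\<^sub>R (2 *\<^sub>R w)"
    proof (rule dense_image_halving[OF A B _ V(2) _ dense])
      show "norm d \<le> real N" if "d \<in> B N" for d using that by (simp add: B_def)
      show "A ` B N \<subseteq> V" using AV by (auto simp: B_def)
      show "2 *\<^sub>R w \<in> V" using V(2) w(1) by (rule subspace_scale)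
      show "norm (2 *\<^sub>R w) < e / m" using w(2) by simp
    qed
    then show ?thesis by (auto simp: B_def)
  qed
  moreover have "e / m / 2 > 0" using x(2) \<open>m > 0\<close> by simp
  ultimately show ?thesis unfolding V_def[symmetric] by blast
qed

text \<open>The value function \<open>w \<mapsto> inf {\<tau> e | e \<in> E, L e = w}\<close> is bounded above near \<open>0\<close> on the closed
  subspace \<open>cone hull (L ` E)\<close>. This makes it lower semicontinuous at \<open>0\<close>, so the points \<open>(0, \<mu> - \<epsilon>)\<close>
  can be separated from its epigraph, and it bounds the resulting multipliers uniformly in \<open>\<epsilon>\<close>.\<close>

theorem Attouch_Brezis_multiplier:
  fixes E :: "'a::{real_inner, banach} set" and L :: "'a \<Rightarrow> 'b::{real_inner, banach}"
    and \<tau> :: "'a \<Rightarrow> real"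
  assumes L: "bounded_linear L" and \<tau>: "bounded_linear \<tau>"
    and E: "closed E" "convex E" and sri: "0 \<in> sri (L ` E)"
    and \<mu>: "\<And>e. e \<in> E \<Longrightarrow> L e = 0 \<Longrightarrow> \<mu> \<le> \<tau> e"
  shows "\<exists>u. \<forall>e\<in>E. \<mu> \<le> \<tau> e + u \<bullet> L e"
proof -
  interpret L: bounded_linear L by fact
  interpret \<tau>: bounded_linear \<tau> by fact
  define V where "V = cone hull (L ` E)"
  have V: "closed V" "subspace V" and "0 \<in> L ` E" using sri by (auto simp: sri_def V_def)
  have LV: "L e \<in> V" if "e \<in> E" for e using that by (auto simp: V_def intro: hull_inc)
  obtain e0 where e0: "e0 \<in> E" "L e0 = 0" using \<open>0 \<in> L ` E\<close> by auto
  obtain \<delta> N where \<delta>: "\<delta> > 0"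
    and open_map: "\<And>w. w \<in> V \<Longrightarrow> norm w < \<delta> \<Longrightarrow> \<exists>d\<in>E. norm d \<le> N \<and> L d = w"
    using Robinson_Ursescu[OF L E sri] unfolding V_def by blast
  obtain B where B: "B > 0" "\<And>e. norm (\<tau> e) \<le> norm e * B" using \<tau>.pos_bounded by blast
  define R where "R = \<bar>N\<bar> * B"
  have "R \<ge> 0" using B(1) by (simp add: R_def)
  have local_bound: "\<exists>d\<in>E. L d = w \<and> \<tau> d \<le> R" if w: "w \<in> V" "norm w < \<delta>" for w
  proof -
    obtain d where d: "d \<in> E" "norm d \<le> N" "L d = w" using open_map[OF w] by blast
    have "\<tau> d \<le> norm d * B" using B(2)[of d] by simp
    also have "\<dots> \<le> R" unfolding R_def using d(2) B(1) by (intro mult_right_mono) auto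
    finally show ?thesis using d by blast
  qed
  \<comment> \<open>The joint image of a closed set need not be closed, hence the projection below
    onto the closure and the separate proof that the critical points stay outside it.\<close>
  define Q where "Q = (\<lambda>e. (L e, \<tau> e)) ` E"
  have "bounded_linear (\<lambda>e. (L e, \<tau> e))" by (intro bounded_linear_Pair L \<tau>)
  then have Q: "closed (closure Q)" "convex (closure Q)" "closure Q \<noteq> {}"
    unfolding Q_def using E(2) e0(1)
    by (auto intro!: convex_closure convex_linear_image bounded_linear.linear)
  have in_Q: "(L e, \<tau> e) \<in> closure Q" if "e \<in> E" for e
    using that closure_subset by (fastforce simp: Q_def)
  have Q_V: "closure Q \<subseteq> V \<times> UNIV"
    by (rule closure_minimal) (auto simp: Q_def LV intro: closed_Times V)
  \<comment> \<open>A nearby \<open>e\<close> would be almost feasible with value below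
    \<open>\<mu> - \<epsilon> / 2\<close>. A small multiple of some \<open>d\<close> from the local
    bound cancels \<open>L e\<close>, making a feasible point whose value is still below
    \<open>\<mu>\<close>.\<close>
  have notin: "(0, \<mu> - \<epsilon>) \<notin> closure Q" if "\<epsilon> > 0" for \<epsilon>
  proof
    assume cl: "(0, \<mu> - \<epsilon>) \<in> closure Q"
    define m where "m = \<bar>\<mu>\<bar> + R + 1"
    have "m > 0" using \<open>R \<ge> 0\<close> by (simp add: m_def)
    \<comment> \<open>With this weight the correction by \<open>d\<close> costs at most
      \<open>\<epsilon> / 4\<close>, while \<open>e\<close> has gained
      \<open>\<epsilon> / 2\<close>. The bound \<open>\<theta> * \<delta>\<close> in
      \<open>\<eta>\<close> keeps \<open>L e / \<theta>\<close> within the radius of the local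
      bound.\<close>
    define \<theta> where "\<theta> = \<epsilon> / (4 * m)"
    have \<theta>: "\<theta> > 0" "4 * (\<theta> * m) = \<epsilon>"
      using \<open>\<epsilon> > 0\<close> \<open>m > 0\<close> by (auto simp: \<theta>_def)
    define \<eta> where "\<eta> = min (\<epsilon> / 2) (\<theta> * \<delta>)"
    have "\<eta> > 0" using \<open>\<epsilon> > 0\<close> \<theta>(1) \<delta> by (simp add: \<eta>_def)
    with cl obtain q where q: "q \<in> Q" "dist q (0, \<mu> - \<epsilon>) < \<eta>"
      unfolding closure_approachable by blast
    then obtain e where e: "e \<in> E" "dist (L e, \<tau> e) (0, \<mu> - \<epsilon>) < \<eta>" by (auto simp: Q_def)
    have "norm (L e) < \<eta>" "\<bar>\<tau> e - (\<mu> - \<epsilon>)\<bar> < \<eta>"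
      using dist_fst_le[of "(L e, \<tau> e)" "(0, \<mu> - \<epsilon>)"] dist_snd_le[of "(L e, \<tau> e)" "(0, \<mu> - \<epsilon>)"] e(2)
      by (auto simp: dist_real_def)
    then have Le: "norm (L e) < \<theta> * \<delta>" and "\<bar>\<tau> e - (\<mu> - \<epsilon>)\<bar> < \<epsilon> / 2" by (simp_all add: \<eta>_def)
    then have \<tau>e: "\<tau> e < \<mu> - \<epsilon> / 2" by linarith
    have "norm ((- 1 / \<theta>) *\<^sub>R L e) < \<delta>"
      using Le \<theta>(1) by (simp add: pos_divide_less_eq mult.commute)
    moreover have "(- 1 / \<theta>) *\<^sub>R L e \<in> V" by (intro subspace_scale V LV e(1))
    ultimately obtain d where d: "d \<in> E" "L d = (- 1 / \<theta>) *\<^sub>R L e" "\<tau> d \<le> R"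
      using local_bound by blast
    define e' where "e' = (1 / (1 + \<theta>)) *\<^sub>R e + (\<theta> / (1 + \<theta>)) *\<^sub>R d"
    have "e' \<in> E"
      unfolding e'_def using \<theta>(1) by (intro convexD E e(1) d(1)) (auto simp flip: add_divide_distrib)
    moreover have "L e' = 0"
      using \<theta>(1) by (simp add: e'_def L.add L.scaleR d(2))
    ultimately have "\<mu> \<le> \<tau> e'" by (rule \<mu>)
    also have "\<tau> e' = (\<tau> e + \<theta> * \<tau> d) / (1 + \<theta>)"
      by (simp add: e'_def \<tau>.add \<tau>.scaleR add_divide_distrib)
    finally have "\<mu> * (1 + \<theta>) \<le> \<tau> e + \<theta> * \<tau> d" using \<theta>(1) by (simp add: pos_le_divide_eq)
    also have "\<dots> \<le> \<mu> - \<epsilon> / 2 + \<theta> * R"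
      using \<tau>e d(3) \<theta>(1) by (intro add_mono mult_left_mono) auto
    finally have "\<epsilon> / 2 \<le> \<theta> * (R - \<mu>)" by (simp add: algebra_simps)
    also have "\<dots> \<le> \<theta> * m" using \<theta>(1) by (intro mult_left_mono) (auto simp: m_def)
    finally show False using \<theta>(2) \<open>\<epsilon> > 0\<close> by linarith
  qed
  \<comment> \<open>Keeping \<open>u\<close> in \<open>V\<close> matters: the norm bound further
    down tests \<open>u\<close> with a multiple of itself, which must be a value of
    \<open>L\<close>.\<close>
  have multiplier: "\<exists>u\<in>V. \<forall>e\<in>E. \<mu> - \<epsilon> \<le> \<tau> e + u \<bullet> L e" if "\<epsilon> > 0" for \<epsilon>
  proof -
    obtain q where q: "q \<in> closure Q" "\<And>p. p \<in> closure Q \<Longrightarrow> ((0, \<mu> - \<epsilon>) - q) \<bullet> (p - q) \<le> 0"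
      using hilbert_projection[OF Q] by blast
    obtain z \<rho> where z: "q = (z, \<rho>)" by (cases q)
    have sep: "z \<bullet> z - z \<bullet> L e + (\<mu> - \<epsilon> - \<rho>) * (\<tau> e - \<rho>) \<le> 0" if "e \<in> E" for e
      using q(2)[OF in_Q[OF that]] by (simp add: z inner_prod_def inner_diff_right)
    define c where "c = \<rho> - (\<mu> - \<epsilon>)"
    \<comment> \<open>The hyperplane is not vertical: otherwise the feasible point
      \<open>e0\<close>, with value at least \<open>\<mu>\<close>, would force the projection to be
      \<open>(0, \<mu> - \<epsilon>)\<close> itself.\<close>
    have "c > 0"
    proof (rule ccontr)
      assume "\<not> c > 0"
      have "\<mu> \<le> \<tau> e0" using \<mu> e0 by blast
      then have "\<tau> e0 - \<rho> > 0" using \<open>\<not> c > 0\<close> \<open>\<epsilon> > 0\<close> by (simp add: c_def)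
      then have "0 \<le> (\<mu> - \<epsilon> - \<rho>) * (\<tau> e0 - \<rho>)"
        using \<open>\<not> c > 0\<close> by (intro mult_nonneg_nonneg) (auto simp: c_def)
      moreover have "z \<bullet> z + (\<mu> - \<epsilon> - \<rho>) * (\<tau> e0 - \<rho>) \<le> 0" using sep[OF e0(1)] by (simp add: e0(2))
      ultimately have "z \<bullet> z = 0" "(\<mu> - \<epsilon> - \<rho>) * (\<tau> e0 - \<rho>) \<le> 0"
        using inner_ge_zero[of z] by linarith+
      then have "z = 0" "\<rho> = \<mu> - \<epsilon>"
        using \<open>\<tau> e0 - \<rho> > 0\<close> \<open>\<not> c > 0\<close> by (auto simp: c_def mult_le_0_iff)
      then show False using q(1) notin[OF \<open>\<epsilon> > 0\<close>] by (simp add: z)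
    qed
    have "\<mu> - \<epsilon> \<le> \<tau> e + ((1 / c) *\<^sub>R z) \<bullet> L e" if "e \<in> E" for e
    proof -
      have "(\<mu> - \<epsilon> - \<rho>) * (\<tau> e - \<rho>) = - (c * (\<tau> e - \<rho>))" by (simp add: c_def algebra_simps)
      with sep[OF that] have "- (z \<bullet> L e) \<le> c * (\<tau> e - \<rho>)"
        using inner_ge_zero[of z] by linarith
      then have "- (z \<bullet> L e) / c \<le> \<tau> e - \<rho>" using \<open>c > 0\<close> by (subst pos_divide_le_eq) (simp_all add: mult.commute)
      then show ?thesis using \<open>c > 0\<close> by (simp add: c_def)
    qed
    moreover have "(1 / c) *\<^sub>R z \<in> V" using q(1) Q_V V(2) by (auto simp: z intro: subspace_scale)
    ultimately show ?thesis by blast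
  qed
  have "\<exists>u\<in>V. \<forall>e\<in>E. \<mu> - inverse (real (Suc n)) \<le> \<tau> e + u \<bullet> L e" for n
    by (rule multiplier) simp
  then obtain u where u: "\<And>n. u n \<in> V"
    "\<And>n e. e \<in> E \<Longrightarrow> \<mu> - inverse (real (Suc n)) \<le> \<tau> e + u n \<bullet> L e"
    by metis
  have "norm (u n) \<le> 2 * (R + \<bar>\<mu>\<bar> + 1) / \<delta>" for n
  proof -
    \<comment> \<open>Pointing against \<open>u n\<close>, this value of \<open>L\<close> is
      attained with cost at most \<open>R\<close>, so a large multiplier would violate its own
      inequality.\<close>
    define w where "w = (- (\<delta> / 2)) *\<^sub>R sgn (u n)"
    have "w \<in> V" unfolding w_def sgn_div_norm by (intro subspace_scale V u(1))
    moreover have "norm w < \<delta>" using \<delta> by (simp add: w_def norm_sgn)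
    ultimately obtain d where d: "d \<in> E" "L d = w" "\<tau> d \<le> R" using local_bound by blast
    have "u n \<bullet> sgn (u n) = norm (u n)"
      by (cases "u n = 0") (simp_all add: sgn_div_norm dot_square_norm power2_eq_square)
    then have "u n \<bullet> w = - (\<delta> / 2 * norm (u n))" by (simp add: w_def)
    then have "\<delta> / 2 * norm (u n) \<le> R - \<mu> + inverse (real (Suc n))"
      using u(2)[OF d(1), of n] d(2,3) by simp
    also have "\<dots> \<le> R + \<bar>\<mu>\<bar> + 1" using inverse_le_1_iff[of "real (Suc n)"] by (simp add: add_mono)
    finally show ?thesis using \<delta> by (simp add: pos_le_divide_eq algebra_simps)
  qed
  then obtain r l where r: "strict_mono r" "weakly_converges (u \<circ> r) l"
    using bounded_weakly_convergent_subseq by blast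
  have "\<mu> \<le> \<tau> e + l \<bullet> L e" if "e \<in> E" for e
  proof (rule LIMSEQ_le)
    show "(\<lambda>n. \<mu> - inverse (real (Suc (r n)))) \<longlonglongrightarrow> \<mu>"
      using LIMSEQ_subseq_LIMSEQ[OF LIMSEQ_inverse_real_of_nat_add_minus[of \<mu>] r(1)] by (simp add: o_def)
    show "(\<lambda>n. \<tau> e + u (r n) \<bullet> L e) \<longlonglongrightarrow> \<tau> e + l \<bullet> L e"
      using r(2) by (intro tendsto_add tendsto_const) (simp add: weakly_converges_def o_def)
    show "\<exists>N. \<forall>n\<ge>N. \<mu> - inverse (real (Suc (r n))) \<le> \<tau> e + u (r n) \<bullet> L e"
      using u(2)[OF that] by blast
  qed
  then show ?thesis by blast
qed

text \<open>The hard inclusion of the chain rule. The identity \<open>u = T* z\<close> becomes a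
  linear constraint on \<open>epi g* \<times> UNIV\<close>, whose image is the set of the range
  condition; minus its multiplier is the point sought.\<close>

lemma subgradient_conjugate_compose_adjoint:
  fixes g :: "'k::{real_inner, banach} \<Rightarrow> ereal" and T :: "'k \<Rightarrow> 'g::{real_inner, banach}"
  assumes g: "g \<in> Gamma0" and T: "bounded_linear T"
    and sri: "0 \<in> sri (minkowski_diff (edom (fenchel_conjugate g)) (range (adjoint T)))"
    and sub: "is_subgradient (\<lambda>s. fenchel_conjugate g (adjoint T s)) s a"
  shows "\<exists>p. T p = a \<and> is_subgradient g p (adjoint T s)"
proof -
  let ?g = "fenchel_conjugate g" and ?T = "adjoint T"
  obtain c where c: "?g (?T s) = ereal c"
    and sub_c: "\<And>z t. ?g (?T z) \<le> ereal t \<Longrightarrow> c + (z - s) \<bullet> a \<le> t"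
    using sub by (auto simp: is_subgradient_def)
  have T': "bounded_linear ?T" by (rule adjoint_bounded_linear[OF T])
  define L where "L = (\<lambda>q::('k \<times> real) \<times> 'g. fst (fst q) - ?T (snd q))"
  define \<tau> where "\<tau> = (\<lambda>q::('k \<times> real) \<times> 'g. snd (fst q) - a \<bullet> snd q)"
  have "L ` (epi ?g \<times> UNIV) = minkowski_diff (fst ` epi ?g) (range ?T)"
    by (force simp: L_def minkowski_diff_def)
  then have sri': "0 \<in> sri (L ` (epi ?g \<times> UNIV))" using sri by (simp add: fst_epi)
  have "\<exists>p. \<forall>q\<in>epi ?g \<times> UNIV. c - a \<bullet> s \<le> \<tau> q + p \<bullet> L q"
  proof (rule Attouch_Brezis_multiplier[OF _ _ _ _ sri'])
    show "bounded_linear L" unfolding L_def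
      by (intro bounded_linear_intros bounded_linear_compose[OF T'])
    show "bounded_linear \<tau>" unfolding \<tau>_def
      by (intro bounded_linear_intros)
    show "closed (epi ?g \<times> (UNIV::'g set))" "convex (epi ?g \<times> (UNIV::'g set))"
      by (intro closed_Times convex_Times epi_fenchel_conjugate closed_UNIV convex_UNIV)+
    show "c - a \<bullet> s \<le> \<tau> q" if "q \<in> epi ?g \<times> UNIV" "L q = 0" for q
    proof -
      obtain u t z where q: "q = ((u, t), z)" by (cases q) auto
      have "?g (?T z) \<le> ereal t" using that by (simp add: q L_def)
      from sub_c[OF this] show ?thesis
        by (simp add: q \<tau>_def inner_diff_left inner_commute[of a])
    qed
  qed
  then obtain p' where p': "\<And>q. q \<in> epi ?g \<times> UNIV \<Longrightarrow> c - a \<bullet> s \<le> \<tau> q + p' \<bullet> L q" by blast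
  define p where "p = - p'"
  have p: "c - a \<bullet> s \<le> t - a \<bullet> z - p \<bullet> (u - ?T z)" if "?g u \<le> ereal t" for u t z
    using p'[of "((u, t), z)"] that by (simp add: \<tau>_def L_def p_def)
  have "T p = a"
  proof (rule ccontr)
    assume "T p \<noteq> a"
    define d where "d = T p - a"
    have "d \<bullet> d > 0" using \<open>T p \<noteq> a\<close> by (simp add: d_def)
    \<comment> \<open>The variable \<open>z\<close> is unconstrained, so a nonzero linear
      coefficient \<open>d\<close> is impossible; this step length makes the decrease exactly
      one.\<close>
    define z where "z = s - (1 / (d \<bullet> d)) *\<^sub>R d"
    have "c - a \<bullet> s \<le> c - a \<bullet> z - p \<bullet> (?T s - ?T z)" using p[of "?T s" c z] c by simp
    also have "\<dots> = c - a \<bullet> s + d \<bullet> (z - s)"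
      by (simp add: adjoint_inner[OF T, symmetric] d_def inner_diff_left inner_diff_right)
    also have "d \<bullet> (z - s) = -1" using \<open>d \<bullet> d > 0\<close> by (simp add: z_def)
    finally show False by simp
  qed
  have "c + (u - ?T s) \<bullet> p \<le> t" if "?g u \<le> ereal t" for u t
    using p[OF that, of s] by (simp add: inner_commute[of p])
  then have "is_subgradient ?g (?T s) p"
    using c by (auto simp: is_subgradient_def)
  then show ?thesis using is_subgradient_of_conjugate[OF g] \<open>T p = a\<close> by blast
qed

text \<open>Minimises the sum of heights over \<open>epi g \<times> epi h\<close> under the coupling
  constraint. Freezing either variable at its optimum splits the multiplier inequality into two
  subgradient inequalities.\<close>

lemma Lagrange_multiplier:
  fixes g :: "'k::{real_inner, banach} \<Rightarrow> ereal" and h :: "'j::{real_inner, banach} \<Rightarrow> ereal"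
    and L :: "'k \<Rightarrow> 'h::{real_inner, banach}" and M :: "'j \<Rightarrow> 'h"
  assumes g: "g \<in> Gamma0" and h: "h \<in> Gamma0" and L: "bounded_linear L" and M: "bounded_linear M"
    and sri: "0 \<in> sri (L ` edom g + M ` edom h)"
    and feasible: "L y + M v = 0"
    and minimal: "\<And>y' v'. L y' + M v' = 0 \<Longrightarrow> g y + h v \<le> g y' + h v'"
  shows "\<exists>x. is_subgradient g y (- adjoint L x) \<and> is_subgradient h v (- adjoint M x)"
proof -
  note ninf = Gamma0_epi(4)[OF g] Gamma0_epi(4)[OF h]
  \<comment> \<open>The qualification also supplies a feasible point inside both domains, hence a
    finite optimal value.\<close>
  have "0 \<in> L ` edom g + M ` edom h" using sri by (simp add: sri_def)
  then obtain y0 v0 where 0: "g y0 < \<infinity>" "h v0 < \<infinity>" "L y0 + M v0 = 0"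
    by (auto simp: set_plus_def edom_def)
  have "g y + h v < \<infinity>"
    using minimal[OF 0(3)] 0(1,2) by (auto intro: order_le_less_trans)
  then obtain r s where rs: "g y = ereal r" "h v = ereal s"
    using ninf by (cases "g y"; cases "h v") auto
  define A where "A = (\<lambda>q::('k \<times> real) \<times> ('j \<times> real). L (fst (fst q)) + M (fst (snd q)))"
  define \<tau> where "\<tau> = (\<lambda>q::('k \<times> real) \<times> ('j \<times> real). snd (fst q) + snd (snd q))"
  have "A ` (epi g \<times> epi h) = L ` (fst ` epi g) + M ` (fst ` epi h)"
    by (force simp: A_def set_plus_def)
  then have sri': "0 \<in> sri (A ` (epi g \<times> epi h))" using sri by (simp add: fst_epi)
  have "\<exists>x. \<forall>q\<in>epi g \<times> epi h. r + s \<le> \<tau> q + x \<bullet> A q"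
  proof (rule Attouch_Brezis_multiplier[OF _ _ _ _ sri'])
    show "bounded_linear A" unfolding A_def
      by (intro bounded_linear_intros bounded_linear_compose[OF L] bounded_linear_compose[OF M])
    show "bounded_linear \<tau>" unfolding \<tau>_def by (intro bounded_linear_intros)
    show "closed (epi g \<times> epi h)" "convex (epi g \<times> epi h)"
      by (intro closed_Times convex_Times Gamma0_epi g h)+
    show "r + s \<le> \<tau> q" if "q \<in> epi g \<times> epi h" "A q = 0" for q
    proof -
      obtain y' t v' t' where q: "q = ((y', t), (v', t'))" by (cases q) auto
      have "ereal (r + s) \<le> g y' + h v'" using minimal[of y' v'] that(2) rs by (simp add: A_def q)
      also have "\<dots> \<le> ereal t + ereal t'" using that(1) by (intro add_mono) (auto simp: q)
      finally show ?thesis by (simp add: q \<tau>_def)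
    qed
  qed
  then obtain x where x': "\<And>q. q \<in> epi g \<times> epi h \<Longrightarrow> r + s \<le> \<tau> q + x \<bullet> A q" by blast
  have x: "r + s \<le> t + t' + x \<bullet> (L y' + M v')" if "g y' \<le> ereal t" "h v' \<le> ereal t'" for y' t v' t'
    using x'[of "((y', t), (v', t'))"] that by (simp add: \<tau>_def A_def)
  have "r + (y' - y) \<bullet> (- adjoint L x) \<le> t" if "g y' \<le> ereal t" for y' t
  proof -
    have "L y' + M v = L (y' - y)"
      using feasible by (simp add: linear_diff[OF bounded_linear.linear[OF L]] add_eq_0_iff)
    moreover have "r + s \<le> t + s + x \<bullet> (L y' + M v)" using x[OF that] rs(2) by simp
    ultimately show ?thesis by (simp add: adjoint_inner[OF L, symmetric] inner_commute[of x])
  qed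
  moreover have "s + (v' - v) \<bullet> (- adjoint M x) \<le> t" if "h v' \<le> ereal t" for v' t
  proof -
    have "L y + M v' = M (v' - v)"
      using feasible by (simp add: linear_diff[OF bounded_linear.linear[OF M]] add_eq_0_iff2)
    moreover have "r + s \<le> r + t + x \<bullet> (L y + M v')" using x[OF _ that, of y r] rs(1) by simp
    ultimately show ?thesis by (simp add: adjoint_inner[OF M, symmetric] inner_commute[of x])
  qed
  ultimately show ?thesis using rs unfolding is_subgradient_def by blast
qed

text \<open>Fermat's rule for a convex function plus a smooth quadratic: compare the minimiser with
  points at distance of order \<open>s\<close> on a segment, divide by \<open>s\<close> and let it
  tend to 0.\<close>

lemma argmin_subgradient:
  fixes f :: "'a::{real_inner, banach} \<Rightarrow> ereal" and A :: "'a \<Rightarrow> 'b::real_inner"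
  assumes f: "f \<in> Gamma0" and A: "bounded_linear A"
    and U: "linear U" "self_adjoint U" "\<And>x. 0 \<le> x \<bullet> U x"
    and min: "is_arg_min (\<lambda>x. f x + ereal (1/2 * (norm_wrt U (A x - b))\<^sup>2)) (\<lambda>_. True) z"
  shows "is_subgradient f z (- adjoint A (U (A z - b)))"
proof -
  interpret A: bounded_linear A by fact
  interpret U: linear U by (rule U(1))
  \<comment> \<open>\<open>norm_wrt\<close> contains a square root, which squares back to the
    quadratic form because \<open>U\<close> is positive.\<close>
  define q where "q x = 1/2 * ((A x - b) \<bullet> U (A x - b))" for x
  have le: "f z + ereal (q z) \<le> f x + ereal (q x)" for x
    using min U(3) by (auto simp: is_arg_min_linorder norm_wrt_def q_def)
  obtain x0 t0 where "f x0 \<le> ereal t0" using Gamma0_epi(3)[OF f] by (auto simp: epi_def)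
  then have "f z + ereal (q z) \<le> ereal (t0 + q x0)"
    using order_trans[OF le[of x0] add_right_mono[of "f x0" "ereal t0"]] by simp
  then obtain r where r: "f z = ereal r" using Gamma0_epi(4)[OF f, of z] by (cases "f z") auto
  have "r + (x - z) \<bullet> (- adjoint A (U (A z - b))) \<le> t" if x: "f x \<le> ereal t" for x t
  proof -
    define a c where "a = A (x - z)" and "c = U (A z - b)"
    have quad: "0 \<le> s * (t - r + a \<bullet> c) + s\<^sup>2 * (1/2 * (a \<bullet> U a))" if s: "0 < s" "s < 1" for s
    proof -
      let ?w = "(1 - s) *\<^sub>R z + s *\<^sub>R x"
      have "f ?w \<le> ereal (1 - s) * f z + ereal s * f x"
        using f s by (auto simp: Gamma0_def convex_function_def)
      also have "\<dots> \<le> ereal (1 - s) * ereal r + ereal s * ereal t"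
        using s x r by (intro add_mono ereal_mult_left_mono) auto
      finally have "f ?w + ereal (q ?w) \<le> ereal ((1 - s) * r + s * t + q ?w)"
        using add_right_mono[of "f ?w" "ereal ((1 - s) * r + s * t)" "ereal (q ?w)"] by simp
      from order_trans[OF le[of ?w] this]
      have "r + q z \<le> (1 - s) * r + s * t + q ?w" using r by simp
      moreover have "q ?w = q z + s * (a \<bullet> c) + s\<^sup>2 * (1/2 * (a \<bullet> U a))"
      proof -
        define e where "e = A z - b"
        have "A ?w - b = e + s *\<^sub>R a" by (simp add: a_def e_def A.add A.diff A.scaleR algebra_simps)
        then have "q ?w = 1/2 * ((e + s *\<^sub>R a) \<bullet> (c + s *\<^sub>R U a))"
          by (simp only: q_def U.add U.scale c_def e_def)
        moreover have "e \<bullet> U a = a \<bullet> c"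
          using U(2) unfolding self_adjoint_def c_def e_def by (metis inner_commute)
        moreover have "q z = 1/2 * (e \<bullet> c)" by (simp add: q_def e_def c_def)
        ultimately show ?thesis
          by (simp add: inner_add_left inner_add_right power2_eq_square algebra_simps)
      qed
      ultimately show ?thesis by (simp add: algebra_simps)
    qed
    have "0 \<le> t - r + a \<bullet> c"
    proof (rule tendsto_lowerbound)
      show "((\<lambda>s. t - r + a \<bullet> c + s * (1/2 * (a \<bullet> U a))) \<longlongrightarrow> t - r + a \<bullet> c) (at_right 0)"
        by (rule tendsto_eq_intros refl | simp)+
      show "\<forall>\<^sub>F s in at_right 0. 0 \<le> t - r + a \<bullet> c + s * (1/2 * (a \<bullet> U a))"
        unfolding eventually_at_right_field
      proof (intro exI[of _ 1] conjI allI impI)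
        fix s :: real assume s: "0 < s" "s < 1"
        have "0 \<le> s * (t - r + a \<bullet> c + s * (1/2 * (a \<bullet> U a)))"
          using quad[OF s] by (simp only: distrib_left power2_eq_square mult.assoc)
        then show "0 \<le> t - r + a \<bullet> c + s * (1/2 * (a \<bullet> U a))" using s(1) by (simp only: zero_le_mult_iff) auto
      qed simp
    qed simp
    then show ?thesis by (simp add: adjoint_inner[OF A, symmetric] a_def c_def)
  qed
  then show ?thesis using r by (auto simp: is_subgradient_def)
qed

subsection \<open>Weak limits\<close>

lemma weakly_converges_Pair:
  "weakly_converges (\<lambda>n. (X n, Y n)) (a, b) \<longleftrightarrow> weakly_converges X a \<and> weakly_converges Y b"
proof
  assume lim: "weakly_converges (\<lambda>n. (X n, Y n)) (a, b)"
  have "(\<lambda>n. (X n, Y n) \<bullet> (z, w)) \<longlonglongrightarrow> (a, b) \<bullet> (z, w)" for z w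
    using lim unfolding weakly_converges_def by blast
  from this[of _ 0] this[of 0] show "weakly_converges X a \<and> weakly_converges Y b"
    by (simp add: weakly_converges_def)
qed (auto simp: weakly_converges_def intro: tendsto_add)

lemma weakly_converges_add_null:
  assumes "weakly_converges X a" "e \<longlonglongrightarrow> 0"
  shows "weakly_converges (\<lambda>n. X n + e n) a"
  unfolding weakly_converges_def inner_add_left
proof
  fix z
  have "(\<lambda>n. X n \<bullet> z + e n \<bullet> z) \<longlonglongrightarrow> a \<bullet> z + 0 \<bullet> z"
  proof (rule tendsto_add)
    show "(\<lambda>n. X n \<bullet> z) \<longlonglongrightarrow> a \<bullet> z" using assms(1) by (simp add: weakly_converges_def)
    show "(\<lambda>n. e n \<bullet> z) \<longlonglongrightarrow> 0 \<bullet> z" by (intro tendsto_inner tendsto_const assms(2))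
  qed
  then show "(\<lambda>n. X n \<bullet> z + e n \<bullet> z) \<longlonglongrightarrow> a \<bullet> z" by simp
qed

text \<open>Mazur's theorem: test the sequence against the vector from the projection of the limit
  to the limit.\<close>

lemma weakly_converges_in_closed_convex:
  fixes S :: "'a::{real_inner, banach} set"
  assumes "closed S" "convex S" "\<And>n. X n \<in> S" "weakly_converges X l"
  shows "l \<in> S"
proof -
  have "S \<noteq> {}" using assms(3) by blast
  then obtain z where z: "z \<in> S" "\<And>y. y \<in> S \<Longrightarrow> (l - z) \<bullet> (y - z) \<le> 0"
    using hilbert_projection[OF assms(1,2) \<open>S \<noteq> {}\<close>] by blast
  have "(\<lambda>n. X n \<bullet> (l - z) - z \<bullet> (l - z)) \<longlonglongrightarrow> l \<bullet> (l - z) - z \<bullet> (l - z)"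
    using assms(4) by (intro tendsto_diff tendsto_const) (simp add: weakly_converges_def)
  then have "l \<bullet> (l - z) - z \<bullet> (l - z) \<le> 0"
  proof (rule LIMSEQ_le_const2, intro exI[of _ 0] allI impI)
    show "X n \<bullet> (l - z) - z \<bullet> (l - z) \<le> 0" for n
      using z(2)[OF assms(3)[of n]] by (simp only: inner_diff_left[symmetric] inner_commute)
  qed
  then have "(l - z) \<bullet> (l - z) = 0" using inner_ge_zero[of "l - z"] by (simp add: inner_diff_left)
  then show ?thesis using z(1) by simp
qed

text \<open>For a possibly degenerate form, smallness of \<open>w \<bullet> M w\<close> says little
  about \<open>w\<close>, but it does control \<open>M w\<close>.\<close>

lemma positive_operator_bound:
  fixes M :: "'a::real_inner \<Rightarrow> 'a"
  assumes M: "bounded_linear M" "self_adjoint M" "\<And>w. 0 \<le> w \<bullet> M w"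
  shows "\<exists>C. \<forall>w. (norm (M w))\<^sup>2 \<le> C * (w \<bullet> M w)"
proof -
  interpret M: bounded_linear M by (rule M(1))
  obtain C where C: "C > 0" "\<And>w. norm (M w) \<le> norm w * C" using M.pos_bounded by blast
  have "(norm (M w))\<^sup>2 \<le> C * (w \<bullet> M w)" for w
  proof -
    \<comment> \<open>A gradient step of length \<open>1 / C\<close> for the quadratic form: the
      linear term gains twice what the quadratic term can cost.\<close>
    define v where "v = (1 / C) *\<^sub>R M w"
    have "0 \<le> (w - v) \<bullet> M (w - v)" by (rule M(3))
    also have "\<dots> = w \<bullet> M w - 2 * (v \<bullet> M w) + v \<bullet> M v"
    proof -
      have "w \<bullet> M v = v \<bullet> M w" using M(2) unfolding self_adjoint_def by (metis inner_commute)
      then show ?thesis by (simp add: M.diff inner_diff_left inner_diff_right)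
    qed
    also have "v \<bullet> M v \<le> norm v * (norm v * C)"
      using order_trans[OF norm_cauchy_schwarz mult_left_mono[OF C(2) norm_ge_zero]] .
    also have "norm v * (norm v * C) = (norm (M w))\<^sup>2 / C"
      using C(1) by (simp add: v_def power2_eq_square)
    also have "v \<bullet> M w = (norm (M w))\<^sup>2 / C"
      by (simp add: v_def power2_norm_eq_inner)
    finally have "(norm (M w))\<^sup>2 / C \<le> w \<bullet> M w" by simp
    then show ?thesis using C(1) by (simp add: pos_divide_le_eq mult.commute)
  qed
  then show ?thesis by blast
qed

text \<open>Opial's argument shows only that \<open>M\<close> annihilates the difference of two
  cluster points; injectivity is therefore asked on differences of points of
  \<open>Z\<close>.\<close>

lemma Opial_seminorm:
  fixes M :: "'a::{real_inner, banach} \<Rightarrow> 'a"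
  assumes M: "bounded_linear M" "self_adjoint M" "\<And>w. 0 \<le> w \<bullet> M w"
    and bnd: "\<And>n. norm (W n) \<le> B"
    and cluster: "\<And>r l. strict_mono r \<Longrightarrow> weakly_converges (W \<circ> r) l \<Longrightarrow> l \<in> Z"
    and conv: "\<And>z. z \<in> Z \<Longrightarrow> convergent (\<lambda>n. (W n - z) \<bullet> M (W n - z))"
    and inj: "\<And>z z'. z \<in> Z \<Longrightarrow> z' \<in> Z \<Longrightarrow> M (z - z') = 0 \<Longrightarrow> z = z'"
  shows "\<exists>l\<in>Z. weakly_converges W l"
proof -
  interpret M: bounded_linear M by (rule M(1))
  obtain r l where r: "strict_mono r" "weakly_converges (W \<circ> r) l"
    using bounded_weakly_convergent_subseq[of W B, OF bnd] by blast
  have l: "l \<in> Z" using cluster r by blast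
  have "weakly_converges W l"
  proof (rule weakly_converges_if_unique_cluster[OF bnd])
    fix q m assume q: "strict_mono q" "weakly_converges (W \<circ> q) m"
    have m: "m \<in> Z" using cluster q by blast
    define d where "d = M (l - m)"
    have swap: "M x \<bullet> y = x \<bullet> M y" for x y using M(2) by (simp add: self_adjoint_def)
    \<comment> \<open>In the difference of the two squared seminorms the term quadratic in
      \<open>W n\<close> cancels, so a convergent linear functional of \<open>W n\<close>
      remains.\<close>
    have eq: "W n \<bullet> d = 1/2 * ((W n - m) \<bullet> M (W n - m) - (W n - l) \<bullet> M (W n - l) + (l \<bullet> M l - m \<bullet> M m))" for n
      unfolding d_def using swap[of "W n" l] swap[of "W n" m]
      by (simp add: M.diff inner_diff_left inner_diff_right inner_commute[of l "M (W n)"]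
          inner_commute[of m "M (W n)"] algebra_simps)
    have "convergent (\<lambda>n. 1/2 * ((W n - m) \<bullet> M (W n - m) - (W n - l) \<bullet> M (W n - l) + (l \<bullet> M l - m \<bullet> M m)))"
      by (intro convergent_mult convergent_add convergent_diff convergent_const conv l m)
    then have "convergent (\<lambda>n. W n \<bullet> d)" by (simp only: eq)
    then obtain c where c: "(\<lambda>n. W n \<bullet> d) \<longlonglongrightarrow> c" by (auto simp: convergent_def)
    have "l \<bullet> d = c" "m \<bullet> d = c"
      using LIMSEQ_subseq_LIMSEQ[OF c] r q LIMSEQ_unique
      unfolding weakly_converges_def o_def by blast+
    then have "(l - m) \<bullet> d = 0" by (simp add: inner_diff_left)
    moreover obtain C where "(norm d)\<^sup>2 \<le> C * ((l - m) \<bullet> d)"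
      using positive_operator_bound[OF M] unfolding d_def by blast
    ultimately have "M (l - m) = 0" by (simp add: d_def)
    then show "m = l" using inj[OF l m] by simp
  qed
  then show ?thesis using l by blast
qed

text \<open>Convergence of the sum of the duality pairings suffices; neither pairing need converge alone.\<close>

lemma subgradient_weak_limit:
  fixes \<phi> :: "'a::{real_inner, banach} \<Rightarrow> ereal" and \<psi> :: "'b::{real_inner, banach} \<Rightarrow> ereal"
  assumes epi: "closed (epi \<phi>)" "convex (epi \<phi>)" "closed (epi \<psi>)" "convex (epi \<psi>)"
    and sub: "\<And>n. is_subgradient \<phi> (s n) (a n)" "\<And>n. is_subgradient \<psi> (t n) (b n)"
    and lim: "weakly_converges s s'" "weakly_converges a a'" "weakly_converges t t'" "weakly_converges b b'"
    and pairing: "(\<lambda>n. s n \<bullet> a n + t n \<bullet> b n) \<longlonglongrightarrow> s' \<bullet> a' + t' \<bullet> b'"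
  shows "is_subgradient \<phi> s' a' \<and> is_subgradient \<psi> t' b'"
proof -
  have "\<exists>r. \<phi> (s n) = ereal r \<and> (\<forall>y c. \<phi> y \<le> ereal c \<longrightarrow> r + (y - s n) \<bullet> a n \<le> c)" for n
    using sub(1) by (simp add: is_subgradient_def)
  then obtain f where f: "\<And>n. \<phi> (s n) = ereal (f n)"
    "\<And>n y c. \<phi> y \<le> ereal c \<Longrightarrow> f n + (y - s n) \<bullet> a n \<le> c" by metis
  have "\<exists>r. \<psi> (t n) = ereal r \<and> (\<forall>y c. \<psi> y \<le> ereal c \<longrightarrow> r + (y - t n) \<bullet> b n \<le> c)" for n
    using sub(2) by (simp add: is_subgradient_def)
  then obtain g where g: "\<And>n. \<psi> (t n) = ereal (g n)"
    "\<And>n y c. \<psi> y \<le> ereal c \<Longrightarrow> g n + (y - t n) \<bullet> b n \<le> c" by metis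
  \<comment> \<open>Collects the pairings so that only their sum occurs together with terms linear
    in \<open>a n\<close> and \<open>b n\<close>.\<close>
  define \<kappa> where "\<kappa> y z n = (s n \<bullet> a n + t n \<bullet> b n) - (a n \<bullet> y + b n \<bullet> z)" for y z n
  have \<kappa>: "\<kappa> y z \<longlonglongrightarrow> (s' - y) \<bullet> a' + (t' - z) \<bullet> b'" for y z
  proof -
    have "\<kappa> y z \<longlonglongrightarrow> (s' \<bullet> a' + t' \<bullet> b') - (a' \<bullet> y + b' \<bullet> z)"
      unfolding \<kappa>_def using lim
      by (intro tendsto_diff tendsto_add pairing) (simp_all add: weakly_converges_def)
    then show ?thesis by (simp add: inner_diff_left inner_commute[of y] inner_commute[of z] algebra_simps)
  qed
  have fg: "f n + g n \<le> c + d + \<kappa> y z n" if "\<phi> y \<le> ereal c" "\<psi> z \<le> ereal d" for y z c d n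
    using f(2)[OF that(1), of n] g(2)[OF that(2), of n]
    by (simp add: \<kappa>_def inner_diff_left inner_commute[of "a n"] inner_commute[of "b n"])
  \<comment> \<open>Subgradients at index 0 bound both value sequences below along weakly convergent
    arguments. With the upper bound on the sum, each sequence is then bounded on both sides and a
    common subsequence of values converges.\<close>
  have lower: "\<exists>L. \<forall>n. L \<le> f n" "\<exists>L. \<forall>n. L \<le> g n"
  proof -
    have "Bseq (\<lambda>n. f 0 + (s n \<bullet> a 0 - s 0 \<bullet> a 0))" "Bseq (\<lambda>n. g 0 + (t n \<bullet> b 0 - t 0 \<bullet> b 0))"
      using lim(1,3) unfolding weakly_converges_def
      by (intro convergent_imp_Bseq convergent_add convergent_diff convergent_const convergentI; blast)+
    then obtain k l where k: "\<And>n. \<bar>f 0 + (s n \<bullet> a 0 - s 0 \<bullet> a 0)\<bar> \<le> k" and l: "\<And>n. \<bar>g 0 + (t n \<bullet> b 0 - t 0 \<bullet> b 0)\<bar> \<le> l"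
      unfolding Bseq_def real_norm_def by blast
    have "- k \<le> f n" for n
      using k[of n] f(2)[of "s n" "f n" 0] f(1)[of n] by (simp add: inner_diff_left)
    moreover have "- l \<le> g n" for n
      using l[of n] g(2)[of "t n" "g n" 0] g(1)[of n] by (simp add: inner_diff_left)
    ultimately show "\<exists>L. \<forall>n. L \<le> f n" "\<exists>L. \<forall>n. L \<le> g n" by blast+
  qed
  then obtain k l where kl: "\<And>n. k \<le> f n" "\<And>n. l \<le> g n" by blast
  obtain u where u: "\<And>n. f n + g n \<le> u"
  proof -
    have "Bseq (\<lambda>n. f 0 + g 0 + \<kappa> (s 0) (t 0) n)"
      using \<kappa> by (intro convergent_imp_Bseq convergent_add convergent_const convergentI)
    then obtain u where u: "\<And>n. \<bar>f 0 + g 0 + \<kappa> (s 0) (t 0) n\<bar> \<le> u"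
      unfolding Bseq_def real_norm_def by blast
    have "f n + g n \<le> u" for n
      using fg[of "s 0" "f 0" "t 0" "g 0" n] f(1)[of 0] g(1)[of 0] abs_le_D1[OF u[of n]] by simp
    then show ?thesis using that by blast
  qed
  have fg_bnd: "(f n, g n) \<in> {k..u - l} \<times> {l..u - k}" for n
    using kl[of n] u[of n] by simp
  have "compact ({k..u - l} \<times> {l..u - k})" by (intro compact_Times compact_Icc)
  then obtain q \<rho> where \<rho>: "strict_mono \<rho>" "((\<lambda>n. (f n, g n)) \<circ> \<rho>) \<longlonglongrightarrow> q"
  proof (rule seq_compactE[OF compact_imp_seq_compact, where f = "\<lambda>n. (f n, g n)"])
    show "\<forall>n. (f n, g n) \<in> {k..u - l} \<times> {l..u - k}" using fg_bnd by blast
  qed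
  obtain f' g' where "q = (f', g')" by (cases q)
  then have lims: "(\<lambda>n. f (\<rho> n)) \<longlonglongrightarrow> f'" "(\<lambda>n. g (\<rho> n)) \<longlonglongrightarrow> g'"
    using tendsto_fst[OF \<rho>(2)] tendsto_snd[OF \<rho>(2)] by (simp_all add: o_def)
  have real_weak: "weakly_converges X m" if "X \<longlonglongrightarrow> m" for X :: "nat \<Rightarrow> real" and m
    using that unfolding weakly_converges_def by (intro allI tendsto_inner tendsto_const)
  have \<phi>': "\<phi> s' \<le> ereal f'"
  proof -
    have "(s', f') \<in> epi \<phi>"
    proof (rule weakly_converges_in_closed_convex[OF epi(1,2)])
      show "weakly_converges (\<lambda>n. (s (\<rho> n), f (\<rho> n))) (s', f')"
        using weakly_converges_subseq[OF lim(1) \<rho>(1)] real_weak[OF lims(1)]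
        by (simp add: weakly_converges_Pair o_def)
    qed (simp add: f(1))
    then show ?thesis by simp
  qed
  have \<psi>': "\<psi> t' \<le> ereal g'"
  proof -
    have "(t', g') \<in> epi \<psi>"
    proof (rule weakly_converges_in_closed_convex[OF epi(3,4)])
      show "weakly_converges (\<lambda>n. (t (\<rho> n), g (\<rho> n))) (t', g')"
        using weakly_converges_subseq[OF lim(3) \<rho>(1)] real_weak[OF lims(2)]
        by (simp add: weakly_converges_Pair o_def)
    qed (simp add: g(1))
    then show ?thesis by simp
  qed
  have main: "f' + g' \<le> c + d + ((s' - y) \<bullet> a' + (t' - z) \<bullet> b')" if "\<phi> y \<le> ereal c" "\<psi> z \<le> ereal d" for y z c d
  proof (rule LIMSEQ_le)
    show "(\<lambda>n. f (\<rho> n) + g (\<rho> n)) \<longlonglongrightarrow> f' + g'" by (intro tendsto_add lims)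
    show "(\<lambda>n. c + d + \<kappa> y z (\<rho> n)) \<longlonglongrightarrow> c + d + ((s' - y) \<bullet> a' + (t' - z) \<bullet> b')"
      using LIMSEQ_subseq_LIMSEQ[OF \<kappa> \<rho>(1)] by (intro tendsto_add tendsto_const) (simp add: o_def)
    show "\<exists>N. \<forall>n\<ge>N. f (\<rho> n) + g (\<rho> n) \<le> c + d + \<kappa> y z (\<rho> n)" using fg[OF that] by blast
  qed
  \<comment> \<open>Putting the limit point in the other slot cancels that function's contribution
    and separates the two inequalities.\<close>
  have sub_\<phi>: "f' + (y - s') \<bullet> a' \<le> c" if "\<phi> y \<le> ereal c" for y c
    using main[OF that \<psi>'] by (simp add: inner_diff_left)
  have sub_\<psi>: "g' + (z - t') \<bullet> b' \<le> d" if "\<psi> z \<le> ereal d" for z d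
    using main[OF \<phi>' that] by (simp add: inner_diff_left)
  have "\<phi> s' = ereal f'"
  proof (rule antisym[OF \<phi>'], rule ccontr)
    assume "\<not> ereal f' \<le> \<phi> s'"
    then have "\<phi> s' < ereal f'" by simp
    from ereal_dense2[OF this] obtain c where "\<phi> s' < ereal c" "c < f'" by auto
    with sub_\<phi>[of s' c] show False by (simp add: less_imp_le)
  qed
  moreover have "\<psi> t' = ereal g'"
  proof (rule antisym[OF \<psi>'], rule ccontr)
    assume "\<not> ereal g' \<le> \<psi> t'"
    then have "\<psi> t' < ereal g'" by simp
    from ereal_dense2[OF this] obtain c where "\<psi> t' < ereal c" "c < g'" by auto
    with sub_\<psi>[of t' c] show False by (simp add: less_imp_le)
  qed
  ultimately show ?thesis using sub_\<phi> sub_\<psi> by (auto simp: is_subgradient_def)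
qed

subsection \<open>The primal-dual iteration\<close>

text \<open>The primal-dual iteration is a proximal point iteration for the operator of the saddle
  conditions, preconditioned by \<open>M\<close>. Only positivity of \<open>M\<close> is available, so boundedness of the
  iterates and uniqueness of the weak limit are recovered from the resolvent structure.\<close>

theorem primal_dual_weak_convergence:
  fixes \<phi> :: "'g::{real_inner, banach} \<Rightarrow> ereal" and \<psi> :: "'h::{real_inner, banach} \<Rightarrow> ereal"
    and K :: "'g \<Rightarrow> 'h" and S :: "'g \<Rightarrow> 'g" and R :: "'h \<Rightarrow> 'h"
    and a :: "nat \<Rightarrow> 'g" and x :: "nat \<Rightarrow> 'h"
  assumes epi: "closed (epi \<phi>)" "convex (epi \<phi>)" "closed (epi \<psi>)" "convex (epi \<psi>)"
    and K: "bounded_linear K"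
    and S: "bounded_linear S" "self_adjoint S" "strongly_monotone S"
    and R: "bounded_linear R" "self_adjoint R" "strongly_monotone R"
    and pos: "\<And>u w. 0 \<le> u \<bullet> S u + 2 * (K u \<bullet> w) + w \<bullet> R w"
    and step_\<psi>: "\<And>n. is_subgradient \<psi> (- x (Suc n)) (R (x (Suc n) - x n) - K (a n))"
    and step_\<phi>: "\<And>n. is_subgradient \<phi>
      (- (S (a (Suc n) - a n) + adjoint K (2 *\<^sub>R x (Suc n) - x n))) (a (Suc n))"
    and saddle0: "is_subgradient \<phi> (- adjoint K x0) a0" "is_subgradient \<psi> (- x0) (- K a0)"
  shows "\<exists>a' x'. is_subgradient \<phi> (- adjoint K x') a' \<and> is_subgradient \<psi> (- x') (- K a') \<and>
    weakly_converges a a' \<and> weakly_converges (\<lambda>n. R (x (Suc n) - x n) - K (a n)) (- K a')"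
proof -
  let ?K = "adjoint K"
  interpret K: bounded_linear K by (rule K)
  interpret S: bounded_linear S by (rule S(1))
  interpret R: bounded_linear R by (rule R(1))
  have K': "bounded_linear ?K" by (rule adjoint_bounded_linear[OF K])
  interpret K': bounded_linear ?K by (rule K')
  have adj: "u \<bullet> ?K w = K u \<bullet> w" "?K w \<bullet> u = w \<bullet> K u" for u w
    by (simp_all add: adjoint_inner[OF K, symmetric] inner_commute[of "?K w"] inner_commute[of w])

  \<comment> \<open>The preconditioner and its quadratic form\<close>
  define M where "M p = (S (fst p) + ?K (snd p), K (fst p) + R (snd p))" for p :: "'g \<times> 'h"
  have M_lin: "bounded_linear M"
    unfolding M_def
    by (intro bounded_linear_Pair bounded_linear_add bounded_linear_compose[OF S(1)]
        bounded_linear_compose[OF R(1)] bounded_linear_compose[OF K] bounded_linear_compose[OF K']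
        bounded_linear_fst bounded_linear_snd)
  interpret M: bounded_linear M by (rule M_lin)
  have M_sa: "self_adjoint M"
    unfolding self_adjoint_def
  proof (intro allI)
    fix p q :: "'g \<times> 'h"
    have "S (fst p) \<bullet> fst q = fst p \<bullet> S (fst q)" "R (snd p) \<bullet> snd q = snd p \<bullet> R (snd q)"
      using S(2) R(2) by (simp_all add: self_adjoint_def)
    then show "M p \<bullet> q = p \<bullet> M q"
      by (simp add: M_def inner_prod_def inner_add_left inner_add_right adj)
  qed
  have M_pos: "0 \<le> p \<bullet> M p" for p
    using pos[of "fst p" "snd p"]
    by (simp add: M_def inner_prod_def inner_add_right adj inner_commute[of _ "K (fst p)"])
  obtain C where C: "\<And>p. (norm (M p))\<^sup>2 \<le> C * (p \<bullet> M p)"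
    using positive_operator_bound[OF M_lin M_sa M_pos] by blast
  obtain \<sigma> where \<sigma>: "\<sigma> > 0" "\<And>u. \<sigma> * (norm u)\<^sup>2 \<le> u \<bullet> S u"
    using S(3) by (auto simp: strongly_monotone_def)
  obtain \<rho> where \<rho>: "\<rho> > 0" "\<And>w. \<rho> * (norm w)\<^sup>2 \<le> w \<bullet> R w"
    using R(3) by (auto simp: strongly_monotone_def)
  define Z where "Z = {(u, w). is_subgradient \<phi> (- ?K w) u \<and> is_subgradient \<psi> (- w) (- K u)}"
  define W where "W n = (a n, x n)" for n
  define e where "e n = M (W (Suc n) - W n)" for n
  define q where "q p = p \<bullet> M p" for p

  \<comment> \<open>Fejer monotonicity in the seminorm of the preconditioner\<close>
  have mono_\<psi>: "(w - x (Suc n)) \<bullet> (R (x (Suc n) - x n) - K (a n) + K u) \<ge> 0"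
    if "(u, w) \<in> Z" for u w n
    using is_subgradient_monotone[OF step_\<psi>[of n], of "- w" "- K u"] that by (simp add: Z_def)
  have mono_\<phi>: "(- (S (a (Suc n) - a n) + ?K (2 *\<^sub>R x (Suc n) - x n - w))) \<bullet> (a (Suc n) - u) \<ge> 0"
    if "(u, w) \<in> Z" for u w n
  proof -
    have "- (S (a (Suc n) - a n) + ?K (2 *\<^sub>R x (Suc n) - x n)) - - ?K w =
        - (S (a (Suc n) - a n) + ?K (2 *\<^sub>R x (Suc n) - x n - w))"
      by (simp add: K'.diff)
    moreover have "is_subgradient \<phi> (- ?K w) u" using that by (simp add: Z_def)
    ultimately show ?thesis using is_subgradient_monotone[OF step_\<phi>[of n]] by metis
  qed

  have fejer: "q (W (Suc n) - z) + q (W (Suc n) - W n) \<le> q (W n - z)" if "z \<in> Z" for z n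
  proof -
    obtain u w where z: "z = (u, w)" by (cases z)
    define \<alpha> \<xi> da dx where "\<alpha> = a (Suc n) - u" and "\<xi> = x (Suc n) - w"
      and "da = a (Suc n) - a n" and "dx = x (Suc n) - x n"
    have \<psi>: "- \<xi> \<bullet> (R dx - K \<alpha> + K da) \<ge> 0"
      using mono_\<psi>[of u w n] that
      by (simp add: z \<xi>_def dx_def \<alpha>_def da_def K.diff algebra_simps)
    have "2 *\<^sub>R x (Suc n) - x n - w = \<xi> + dx" by (simp add: \<xi>_def dx_def scaleR_2)
    then have \<phi>: "- (S da + ?K (\<xi> + dx)) \<bullet> \<alpha> \<ge> 0"
      using mono_\<phi>[of u w n] that by (simp add: z da_def \<alpha>_def)
    \<comment> \<open>Adding the two monotonicity inequalities cancels
      \<open>\<xi> \<bullet> K \<alpha>\<close>. The extrapolation leaves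
      \<open>dx \<bullet> K \<alpha>\<close>, the off-diagonal term that makes the sum exactly a
      pairing with \<open>M\<close>.\<close>
    have "(\<alpha>, \<xi>) \<bullet> M (da, dx) \<le> 0"
    proof -
      have "\<xi> \<bullet> R dx - \<xi> \<bullet> K \<alpha> + \<xi> \<bullet> K da \<le> 0"
        using \<psi> by (simp add: inner_add_right inner_diff_right)
      moreover have "S da \<bullet> \<alpha> + \<xi> \<bullet> K \<alpha> + dx \<bullet> K \<alpha> \<le> 0"
        using \<phi> by (simp add: inner_add_left inner_diff_left K'.add adj)
      moreover have "(\<alpha>, \<xi>) \<bullet> M (da, dx) = S da \<bullet> \<alpha> + dx \<bullet> K \<alpha> + (\<xi> \<bullet> K da + \<xi> \<bullet> R dx)"
        by (simp add: M_def inner_add_right adj(1) inner_commute)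
      ultimately show ?thesis by linarith
    qed
    then have cross: "(W (Suc n) - z) \<bullet> M (W (Suc n) - W n) \<le> 0"
      by (simp add: z W_def \<alpha>_def \<xi>_def da_def dx_def)
    define b d where "b = W (Suc n) - z" and "d = W (Suc n) - W n"
    have "W n - z = b - d" by (simp add: b_def d_def)
    moreover have "d \<bullet> M b = b \<bullet> M d" using M_sa unfolding self_adjoint_def by (metis inner_commute)
    ultimately have "q (W n - z) = q b - 2 * (b \<bullet> M d) + q d"
      by (simp add: q_def M.diff inner_diff_left inner_diff_right)
    then show ?thesis using cross by (simp flip: b_def d_def)
  qed
  have q_nonneg: "0 \<le> q p" for p using M_pos by (simp add: q_def)
  have conv: "convergent (\<lambda>n. q (W n - z))" if "z \<in> Z" for z
  proof -
    have "q (W (Suc n) - z) \<le> q (W n - z)" for n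
      using fejer[OF that, of n] q_nonneg[of "W (Suc n) - W n"] by linarith
    then have "decseq (\<lambda>n. q (W n - z))" by (rule decseq_SucI)
    then obtain l where "(\<lambda>n. q (W n - z)) \<longlonglongrightarrow> l"
      by (rule decseq_convergent[where B = 0]) (use q_nonneg in auto)
    then show ?thesis by (rule convergentI)
  qed

  \<comment> \<open>Vanishing residuals and bounded iterates\<close>
  have z0: "(a0, x0) \<in> Z" using saddle0 by (simp add: Z_def)
  have e_null: "e \<longlonglongrightarrow> 0"
  proof -
    obtain l where l: "(\<lambda>n. q (W n - (a0, x0))) \<longlonglongrightarrow> l" using conv[OF z0] by (auto simp: convergent_def)
    have "(\<lambda>n. \<bar>C\<bar> * (q (W n - (a0, x0)) - q (W (Suc n) - (a0, x0)))) \<longlonglongrightarrow> \<bar>C\<bar> * (l - l)"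
      by (intro tendsto_mult tendsto_diff tendsto_const l LIMSEQ_Suc[OF l])
    then have lim: "(\<lambda>n. \<bar>C\<bar> * (q (W n - (a0, x0)) - q (W (Suc n) - (a0, x0)))) \<longlonglongrightarrow> 0" by simp
    have bound: "(norm (e n))\<^sup>2 \<le> \<bar>C\<bar> * (q (W n - (a0, x0)) - q (W (Suc n) - (a0, x0)))" for n
    proof -
      have "(norm (e n))\<^sup>2 \<le> C * q (W (Suc n) - W n)" unfolding e_def q_def by (rule C)
      also have "\<dots> \<le> \<bar>C\<bar> * q (W (Suc n) - W n)" using q_nonneg by (intro mult_right_mono) auto
      also have "\<dots> \<le> \<bar>C\<bar> * (q (W n - (a0, x0)) - q (W (Suc n) - (a0, x0)))"
        using fejer[OF z0, of n] by (intro mult_left_mono) auto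
      finally show ?thesis .
    qed
    have "(\<lambda>n. (norm (e n))\<^sup>2) \<longlonglongrightarrow> 0"
    proof (rule Lim_null_comparison[OF _ lim])
      show "\<forall>\<^sub>F n in sequentially. norm ((norm (e n))\<^sup>2)
          \<le> \<bar>C\<bar> * (q (W n - (a0, x0)) - q (W (Suc n) - (a0, x0)))"
        using bound by (intro always_eventually allI) simp
    qed
    then have "(\<lambda>n. norm (e n)) \<longlonglongrightarrow> 0"
      using tendsto_real_sqrt[of "\<lambda>n. (norm (e n))\<^sup>2"] by simp
    then show ?thesis by (rule tendsto_norm_zero_cancel)
  qed

  \<comment> \<open>The seminorm bounds only \<open>M (W n - (a0, x0))\<close>. Its second component
    controls \<open>x (Suc n)\<close> by strong monotonicity of \<open>R\<close>; with that bound,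
    its first component controls \<open>a (Suc n)\<close> by that of \<open>S\<close>. The bound
    thus concerns the shifted sequence.\<close>
  obtain B where B: "\<And>n. norm (W (Suc n)) \<le> B"
  proof -
    define D where "D = sqrt (\<bar>C\<bar> * q (W 0 - (a0, x0)))"
    have D: "norm (M (W n - (a0, x0))) \<le> D" for n
    proof -
      have "q (W n - (a0, x0)) \<le> q (W 0 - (a0, x0))"
      proof (induction n)
        case (Suc n) then show ?case using fejer[OF z0, of n] q_nonneg[of "W (Suc n) - W n"] by linarith
      qed simp
      then have "\<bar>C\<bar> * q (W n - (a0, x0)) \<le> \<bar>C\<bar> * q (W 0 - (a0, x0))" by (rule mult_left_mono) simp
      moreover have "C * q (W n - (a0, x0)) \<le> \<bar>C\<bar> * q (W n - (a0, x0))"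
        using q_nonneg by (intro mult_right_mono) auto
      ultimately have "(norm (M (W n - (a0, x0))))\<^sup>2 \<le> \<bar>C\<bar> * q (W 0 - (a0, x0))"
        using C[of "W n - (a0, x0)"] unfolding q_def by linarith
      then show ?thesis unfolding D_def by (rule real_le_rsqrt)
    qed
    obtain k where k: "\<And>w. norm (?K w) \<le> norm w * k" "k > 0" using K'.pos_bounded by blast
    have comp: "norm (S (a n - a0) + ?K (x n - x0)) \<le> D" "norm (K (a n - a0) + R (x n - x0)) \<le> D" for n
      using D[of n] norm_fst_le[of "S (a n - a0) + ?K (x n - x0)" "K (a n - a0) + R (x n - x0)"]
        norm_snd_le[of "K (a n - a0) + R (x n - x0)" "S (a n - a0) + ?K (x n - x0)"]
      by (auto simp: M_def W_def)
    have cancel: "norm v \<le> d / c" if "c > 0" "c * (norm v)\<^sup>2 \<le> norm v * d" "0 \<le> d" for v :: "'z::real_normed_vector" and c d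
    proof (cases "v = 0")
      case False
      have "norm v * (c * norm v) \<le> norm v * d" using that(2) by (simp add: power2_eq_square ac_simps)
      then have "c * norm v \<le> d" using False by simp
      then show ?thesis using \<open>c > 0\<close> by (simp add: pos_le_divide_eq mult.commute)
    qed (use that in simp)
    have "0 \<le> D" using D[of 0] norm_ge_zero order_trans by blast
    have X: "norm (x (Suc n) - x0) \<le> D / \<rho>" for n
    proof (rule cancel[OF \<rho>(1)])
      define \<xi> where "\<xi> = x (Suc n) - x0"
      have "\<xi> \<bullet> R \<xi> \<le> \<xi> \<bullet> (K (a n - a0) + R (x n - x0))"
        using mono_\<psi>[OF z0, of n] by (simp add: \<xi>_def R.diff K.diff inner_diff_left inner_diff_right inner_add_right)
      also have "\<dots> \<le> norm \<xi> * D"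
        using order_trans[OF norm_cauchy_schwarz mult_left_mono[OF comp(2) norm_ge_zero]] .
      finally show "\<rho> * (norm (x (Suc n) - x0))\<^sup>2 \<le> norm (x (Suc n) - x0) * D"
        using \<rho>(2)[of \<xi>] unfolding \<xi>_def by linarith
    qed fact
    have A: "norm (a (Suc n) - a0) \<le> (D + 2 * (D / \<rho> * k)) / \<sigma>" for n
    proof (rule cancel[OF \<sigma>(1)])
      define \<alpha> \<xi> where "\<alpha> = a (Suc n) - a0" and "\<xi> = x (Suc n) - x0"
      have "\<alpha> \<bullet> S \<alpha> \<le> \<alpha> \<bullet> ((S (a n - a0) + ?K (x n - x0)) - 2 *\<^sub>R ?K \<xi>)"
      proof -
        have "S (a (Suc n) - a n) + ?K (2 *\<^sub>R x (Suc n) - x n - x0) =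
            S \<alpha> - ((S (a n - a0) + ?K (x n - x0)) - 2 *\<^sub>R ?K \<xi>)"
          by (simp add: \<alpha>_def \<xi>_def S.diff K'.diff K'.scaleR K'.add scaleR_2)
        then have "0 \<le> - (S \<alpha> - ((S (a n - a0) + ?K (x n - x0)) - 2 *\<^sub>R ?K \<xi>)) \<bullet> \<alpha>"
          using mono_\<phi>[OF z0, of n] by (simp only: \<alpha>_def)
        then show ?thesis
          by (simp only: minus_diff_eq inner_commute[of _ \<alpha>] inner_diff_right diff_ge_0_iff_ge)
      qed
      also have "\<dots> \<le> norm \<alpha> * norm ((S (a n - a0) + ?K (x n - x0)) - 2 *\<^sub>R ?K \<xi>)"
        by (rule norm_cauchy_schwarz)
      also have "\<dots> \<le> norm \<alpha> * (D + 2 * (D / \<rho> * k))"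
      proof (intro mult_left_mono order_trans[OF norm_triangle_ineq4] add_mono comp norm_ge_zero)
        have "norm (?K \<xi>) \<le> D / \<rho> * k"
          using order_trans[OF k(1) mult_right_mono[OF X]] k(2) by (simp add: \<xi>_def)
        then show "norm (2 *\<^sub>R ?K \<xi>) \<le> 2 * (D / \<rho> * k)" by simp
      qed
      finally show "\<sigma> * (norm (a (Suc n) - a0))\<^sup>2 \<le> norm (a (Suc n) - a0) * (D + 2 * (D / \<rho> * k))"
        using \<sigma>(2)[of \<alpha>] unfolding \<alpha>_def by linarith
      show "0 \<le> D + 2 * (D / \<rho> * k)" using \<open>0 \<le> D\<close> k(2) \<rho>(1) by simp
    qed
    have "norm (W (Suc n)) \<le> norm (a0, x0) + ((D + 2 * (D / \<rho> * k)) / \<sigma> + D / \<rho>)" for n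
    proof -
      have "W (Suc n) = (a0, x0) + (a (Suc n) - a0, x (Suc n) - x0)" by (simp add: W_def)
      also have "norm \<dots> \<le> norm (a0, x0) + norm (a (Suc n) - a0, x (Suc n) - x0)" by (rule norm_triangle_ineq)
      also have "norm (a (Suc n) - a0, x (Suc n) - x0) \<le> norm (a (Suc n) - a0) + norm (x (Suc n) - x0)"
        by (rule norm_Pair_le)
      finally show ?thesis using A[of n] X[of n] by linarith
    qed
    then show ?thesis by (rule that)
  qed

  \<comment> \<open>Weak cluster points are saddle points\<close>
  have weak_K: "weakly_converges (\<lambda>n. K (X n)) (K m)" if "weakly_converges X m" for X m
    by (rule weakly_converges_bounded_linear[OF K that])
  have b_eq: "R (x (Suc n) - x n) - K (a n) = - K (a (Suc n)) + snd (e n)" for n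
    by (simp add: e_def M_def W_def K.diff)
  have s_eq: "- (S (a (Suc n) - a n) + ?K (2 *\<^sub>R x (Suc n) - x n)) = - ?K (x (Suc n)) + - fst (e n)" for n
  proof -
    have "2 *\<^sub>R x (Suc n) - x n = x (Suc n) + (x (Suc n) - x n)" by (simp add: scaleR_2)
    then have "?K (2 *\<^sub>R x (Suc n) - x n) = ?K (x (Suc n)) + ?K (x (Suc n) - x n)"
      by (simp only: K'.add)
    then show ?thesis by (simp add: e_def M_def W_def)
  qed
  have e_comp: "(\<lambda>n. - fst (e n)) \<longlonglongrightarrow> 0" "(\<lambda>n. snd (e n)) \<longlonglongrightarrow> 0"
    using tendsto_minus[OF tendsto_fst[OF e_null]] tendsto_snd[OF e_null] by simp_all
  have weak_neg: "weakly_converges (\<lambda>n. - X n) (- m)" if "weakly_converges X m" for X and m :: "'z::real_inner"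
    using that by (simp add: weakly_converges_def tendsto_minus)

  have cluster: "z \<in> Z" if r: "strict_mono r" and lim: "weakly_converges ((\<lambda>n. W (Suc n)) \<circ> r) z" for r z
  proof -
    obtain u w where z: "z = (u, w)" by (cases z)
    have ax: "weakly_converges (\<lambda>n. a (Suc (r n))) u" "weakly_converges (\<lambda>n. x (Suc (r n))) w"
      using lim by (simp_all add: z W_def o_def weakly_converges_Pair)
    have er: "(\<lambda>n. e (r n)) \<longlonglongrightarrow> 0" "(\<lambda>n. - fst (e (r n))) \<longlonglongrightarrow> 0" "(\<lambda>n. snd (e (r n))) \<longlonglongrightarrow> 0"
      using LIMSEQ_subseq_LIMSEQ[OF e_null r] LIMSEQ_subseq_LIMSEQ[OF e_comp(1) r]
        LIMSEQ_subseq_LIMSEQ[OF e_comp(2) r] by (simp_all add: o_def)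
    have "is_subgradient \<phi> (- ?K w) u \<and> is_subgradient \<psi> (- w) (- K u)"
    proof (rule subgradient_weak_limit[OF epi])
      show "is_subgradient \<phi> (- ?K (x (Suc (r n))) + - fst (e (r n))) (a (Suc (r n)))" for n
        using step_\<phi>[of "r n"] by (simp only: s_eq)
      show "is_subgradient \<psi> (- x (Suc (r n))) (- K (a (Suc (r n))) + snd (e (r n)))" for n
        using step_\<psi>[of "r n"] by (simp only: b_eq)
      show "weakly_converges (\<lambda>n. - ?K (x (Suc (r n))) + - fst (e (r n))) (- ?K w)"
        by (intro weakly_converges_add_null weak_neg weakly_converges_bounded_linear[OF K'] ax er)
      show "weakly_converges (\<lambda>n. a (Suc (r n))) u" by (rule ax)
      show "weakly_converges (\<lambda>n. - x (Suc (r n))) (- w)" by (intro weak_neg ax)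
      show "weakly_converges (\<lambda>n. - K (a (Suc (r n))) + snd (e (r n))) (- K u)"
        by (intro weakly_converges_add_null weak_neg weak_K ax er)
      \<comment> \<open>The bilinear terms \<open>x \<bullet> K a\<close> need not converge along
        weak limits, but they cancel in the sum of the pairings; what remains is a null sequence
        against a bounded one.\<close>
      have "(\<lambda>n. - (e (r n) \<bullet> W (Suc (r n)))) \<longlonglongrightarrow> 0"
      proof (rule Lim_null_comparison)
        have "\<bar>e (r n) \<bullet> W (Suc (r n))\<bar> \<le> norm (e (r n)) * B" for n
          using order_trans[OF Cauchy_Schwarz_ineq2 mult_left_mono[OF B norm_ge_zero]] .
        then show "\<forall>\<^sub>F n in sequentially. norm (- (e (r n) \<bullet> W (Suc (r n)))) \<le> norm (e (r n)) * B"
          by (intro always_eventually) simp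
        show "(\<lambda>n. norm (e (r n)) * B) \<longlonglongrightarrow> 0"
          using tendsto_mult_right[OF tendsto_norm_zero[OF er(1)], of B] by simp
      qed
      moreover have "(- ?K (x (Suc (r n))) + - fst (e (r n))) \<bullet> a (Suc (r n)) +
          (- x (Suc (r n))) \<bullet> (- K (a (Suc (r n))) + snd (e (r n))) = - (e (r n) \<bullet> W (Suc (r n)))" for n
        by (simp add: W_def inner_prod_def inner_diff_left inner_diff_right adj inner_commute[of "x (Suc (r n))" "snd _"])
      moreover have "(- ?K w) \<bullet> u + (- w) \<bullet> (- K u) = 0" by (simp add: adj)
      ultimately show "(\<lambda>n. (- ?K (x (Suc (r n))) + - fst (e (r n))) \<bullet> a (Suc (r n)) +
          (- x (Suc (r n))) \<bullet> (- K (a (Suc (r n))) + snd (e (r n)))) \<longlonglongrightarrow> (- ?K w) \<bullet> u + (- w) \<bullet> (- K u)"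
        by (simp only:)
    qed
    then show ?thesis by (simp add: z Z_def)
  qed

  \<comment> \<open>Uniqueness of the weak limit\<close>
  have inj: "z = z'" if zz: "z \<in> Z" "z' \<in> Z" "M (z - z') = 0" for z z'
  proof -
    obtain u w u' w' where z: "z = (u, w)" "z' = (u', w')" by (cases z, cases z')
    define \<alpha> \<xi> where "\<alpha> = u - u'" and "\<xi> = w - w'"
    have M0: "S \<alpha> + ?K \<xi> = 0" "K \<alpha> + R \<xi> = 0" using zz(3) by (simp_all add: M_def z \<alpha>_def \<xi>_def zero_prod_def)
    \<comment> \<open>Monotonicity of the second subdifferential gives
      \<open>\<xi> \<bullet> K \<alpha>\<close> a sign opposite to that of
      \<open>- (\<xi> \<bullet> R \<xi>)\<close>, to which it is equal; this kills
      \<open>\<xi>\<close>, and then \<open>\<alpha>\<close>.\<close>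
    have "0 \<le> (- w - - w') \<bullet> (- K u - - K u')"
      using zz(1,2) by (intro is_subgradient_monotone[of \<psi>]) (auto simp: Z_def z)
    also have "\<dots> = \<xi> \<bullet> K \<alpha>" by (simp add: \<alpha>_def \<xi>_def K.diff inner_diff_left inner_diff_right)
    also have "K \<alpha> = - R \<xi>" using M0(2) by (simp add: add_eq_0_iff2)
    finally have "\<rho> * (norm \<xi>)\<^sup>2 \<le> 0" using \<rho>(2)[of \<xi>] by simp
    then have "\<xi> = 0" using \<rho>(1) by (simp add: mult_le_0_iff)
    then have "S \<alpha> = 0" using M0(1) by (simp add: K'.zero)
    then have "\<sigma> * (norm \<alpha>)\<^sup>2 \<le> 0" using \<sigma>(2)[of \<alpha>] by simp
    then have "\<alpha> = 0" using \<sigma>(1) by (simp add: mult_le_0_iff)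
    then show ?thesis using \<open>\<xi> = 0\<close> by (simp add: z \<alpha>_def \<xi>_def)
  qed

  have "\<exists>l\<in>Z. weakly_converges (\<lambda>n. W (Suc n)) l"
  proof (rule Opial_seminorm[OF M_lin M_sa M_pos B cluster _ inj])
    fix z assume "z \<in> Z"
    from conv[OF this] show "convergent (\<lambda>n. (W (Suc n) - z) \<bullet> M (W (Suc n) - z))"
      by (simp add: q_def convergent_Suc_iff[of "\<lambda>n. (W n - z) \<bullet> M (W n - z)"])
  qed
  then obtain a' x' where Z: "(a', x') \<in> Z" and lim: "weakly_converges (\<lambda>n. a (Suc n)) a'"
    by (auto simp: W_def weakly_converges_Pair)
  have "weakly_converges a a'"
    using lim unfolding weakly_converges_def by (auto intro: LIMSEQ_imp_Suc)
  moreover have "weakly_converges (\<lambda>n. - K (a (Suc n)) + snd (e n)) (- K a')"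
    by (intro weakly_converges_add_null weak_neg weak_K lim e_comp)
  ultimately show ?thesis using Z unfolding b_eq by (auto simp: Z_def)
qed

subsection \<open>The saddle problem of (Q)\<close>

text \<open>The easy inclusion of the chain rule: \<open>g p\<close> defines an affine minorant of
  the composition with slope \<open>T p\<close>, and Fenchel-Young equality makes it touch at
  \<open>s\<close>.\<close>

lemma is_subgradient_conjugate_compose_adjoint:
  fixes g :: "'k::{real_inner, banach} \<Rightarrow> ereal" and T :: "'k \<Rightarrow> 'g::real_inner"
  assumes T: "bounded_linear T" and sub: "is_subgradient g p (adjoint T s)"
  shows "is_subgradient (\<lambda>s. fenchel_conjugate g (adjoint T s)) s (T p)"
proof -
  obtain r where r: "g p = ereal r" using sub by (auto simp: is_subgradient_def)
  have "p \<bullet> adjoint T s - r + (z - s) \<bullet> T p \<le> t" if "fenchel_conjugate g (adjoint T z) \<le> ereal t" for z t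
  proof -
    have "p \<bullet> adjoint T z - t \<le> r"
      using that r unfolding fenchel_conjugate_le_iff by simp
    then show ?thesis
      by (simp add: adjoint_inner[OF T, symmetric] inner_diff_right inner_commute[of _ "T p"])
  qed
  then show ?thesis using fenchel_conjugate_subgradient[OF sub r] by (auto simp: is_subgradient_def)
qed

lemma epi_conjugate_compose:
  assumes A: "bounded_linear A"
  shows "closed (epi (\<lambda>s. fenchel_conjugate g (A s)))" "convex (epi (\<lambda>s. fenchel_conjugate g (A s)))"
proof -
  have eq: "epi (\<lambda>s. fenchel_conjugate g (A s)) = (\<lambda>q. (A (fst q), snd q)) -` epi (fenchel_conjugate g)"
    by auto
  have lin: "bounded_linear (\<lambda>q. (A (fst q), snd q))"
    by (intro bounded_linear_Pair bounded_linear_compose[OF A] bounded_linear_fst bounded_linear_snd)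
  show "closed (epi (\<lambda>s. fenchel_conjugate g (A s)))"
    unfolding eq by (intro closed_vimage epi_fenchel_conjugate linear_continuous_on lin)
  show "convex (epi (\<lambda>s. fenchel_conjugate g (A s)))"
    unfolding eq by (intro convex_linear_vimage epi_fenchel_conjugate bounded_linear.linear lin)
qed

text \<open>Adding the two subgradient inequalities, the linear terms combine to the constraint
  difference paired with \<open>x\<close>, which vanishes between feasible points.\<close>

lemma saddle_point_solves_Q:
  fixes g :: "'k::{real_inner, banach} \<Rightarrow> ereal" and h :: "'j::{real_inner, banach} \<Rightarrow> ereal"
    and T :: "'k \<Rightarrow> 'g::{real_inner, banach}" and J :: "'j \<Rightarrow> 'h::{real_inner, banach}"
  assumes g: "g \<in> Gamma0" and h: "h \<in> Gamma0"
    and T: "bounded_linear T" and J: "bounded_linear J" and K: "bounded_linear K"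
    and sub: "is_subgradient g y (adjoint T (- adjoint K x))" "is_subgradient h v (adjoint J (- x))"
    and feasible: "K (T y) + J v = 0"
  shows "solves_Q g h T J K y v"
proof -
  obtain r where r: "g y = ereal r"
    and sub_g: "\<And>y' t. g y' \<le> ereal t \<Longrightarrow> r + (y' - y) \<bullet> adjoint T (- adjoint K x) \<le> t"
    using sub(1) by (auto simp: is_subgradient_def)
  obtain s where s: "h v = ereal s"
    and sub_h: "\<And>v' t. h v' \<le> ereal t \<Longrightarrow> s + (v' - v) \<bullet> adjoint J (- x) \<le> t"
    using sub(2) by (auto simp: is_subgradient_def)
  have "g y + h v \<le> g y' + h v'" if feas': "K (T y') + J v' = 0" for y' v'
  proof (cases "g y' = \<infinity> \<or> h v' = \<infinity>")
    case True
    then show ?thesis using Gamma0_epi(4)[OF g, of y'] Gamma0_epi(4)[OF h, of v'] by auto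
  next
    case False
    then obtain t t' where t: "g y' = ereal t" "h v' = ereal t'"
      using Gamma0_epi(4)[OF g, of y'] Gamma0_epi(4)[OF h, of v'] by (cases "g y'"; cases "h v'") auto
    have "T (y' - y) \<bullet> (- adjoint K x) + J (v' - v) \<bullet> (- x) = - ((K (T (y' - y)) + J (v' - v)) \<bullet> x)"
      by (simp add: adjoint_inner[OF K, symmetric] inner_add_left)
    also have "K (T (y' - y)) + J (v' - v) = 0"
      using feasible feas' T J K by (simp add: linear_diff bounded_linear.linear add_eq_0_iff)
    finally have "T (y' - y) \<bullet> (- adjoint K x) + J (v' - v) \<bullet> (- x) = 0" by simp
    moreover have "r + T (y' - y) \<bullet> (- adjoint K x) \<le> t"
      using sub_g[of y' t] t(1) unfolding adjoint_inner[OF T] by simp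
    moreover have "s + J (v' - v) \<bullet> (- x) \<le> t'"
      using sub_h[of v' t'] t(2) unfolding adjoint_inner[OF J] by simp
    ultimately have "r + s \<le> t + t'" by linarith
    then show ?thesis by (simp add: r s t)
  qed
  then show ?thesis using feasible by (auto simp: solves_Q_def is_arg_min_linorder)
qed

text \<open>Every test vector has the form \<open>adjoint A u\<close>, so it can be moved to the
  image side.\<close>

lemma weakly_converges_preimage:
  fixes A :: "'a::{real_inner, banach} \<Rightarrow> 'b::real_inner"
  assumes A: "bounded_linear A" and surj: "range (adjoint A) = UNIV"
    and lim: "weakly_converges (\<lambda>n. A (X n)) (A l)"
  shows "weakly_converges X l"
  unfolding weakly_converges_def
proof
  fix z
  obtain u where "z = adjoint A u" using surj by (metis UNIV_I imageE)
  then show "(\<lambda>n. X n \<bullet> z) \<longlonglongrightarrow> l \<bullet> z"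
    using lim by (simp add: weakly_converges_def adjoint_inner[OF A, symmetric])
qed

theorem corollary4p8:
  fixes g :: "'k::{real_inner, banach} \<Rightarrow> ereal"
    and h :: "'j::{real_inner, banach} \<Rightarrow> ereal"
    and T :: "'k \<Rightarrow> 'g::{real_inner, banach}"
    and J :: "'j \<Rightarrow> 'h::{real_inner, banach}"
    and K :: "'g \<Rightarrow> 'h"
    and \<Sigma> :: "'g \<Rightarrow> 'g"
    and \<Upsilon> :: "'h \<Rightarrow> 'h"
    and p0 :: 'k and v0 :: 'j and x0 :: 'h
    and p :: "nat \<Rightarrow> 'k" and v :: "nat \<Rightarrow> 'j" and x y :: "nat \<Rightarrow> 'h"
  assumes "g \<in> Gamma0" and "h \<in> Gamma0"
    and "bounded_linear T" and "T \<noteq> (\<lambda>_. 0)"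
    and "bounded_linear J" and "J \<noteq> (\<lambda>_. 0)"
    and "bounded_linear K" and "K \<noteq> (\<lambda>_. 0)"
    and "0 \<in> sri (minkowski_diff (edom (fenchel_conjugate g)) (range (adjoint T)))"
    and "0 \<in> sri (minkowski_diff (edom (fenchel_conjugate h)) (range (adjoint J)))"
    and "0 \<in> sri ((\<lambda>u. K (T u)) ` edom g + J ` edom h)"
    and "\<exists>y' v'. solves_Q g h T J K y' v'"
    and "linear \<Sigma>" and "self_adjoint \<Sigma>" and "strongly_monotone \<Sigma>"
    and "linear \<Upsilon>" and "self_adjoint \<Upsilon>" and "strongly_monotone \<Upsilon>"
    and "monotone_operator (\<lambda>w. inv \<Sigma> w - adjoint K (\<Upsilon> (K w)))"
    and "p 0 = p0" and "v 0 = v0" and "x 0 = x0"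
    and "\<And>n. y n = x n + \<Upsilon> (K (T (p n)) + J (v n))"
    and "\<And>n. is_arg_min
               (\<lambda>q. g q + ereal (1/2 *
                  (norm_wrt (inv \<Sigma>) (T q - (T (p n) - \<Sigma> (adjoint K (y n)))))\<^sup>2))
               (\<lambda>_. True) (p (Suc n))"
    and "\<And>n. is_arg_min
               (\<lambda>w. h w + ereal (1/2 *
                  (norm_wrt \<Upsilon> (J w + K (T (p (Suc n))) + inv \<Upsilon> (x n)))\<^sup>2))
               (\<lambda>_. True) (v (Suc n))"
    and "\<And>n. x (Suc n) = x n + \<Upsilon> (K (T (p (Suc n))) + J (v (Suc n)))"
  shows "\<exists>yh vh. solves_Q g h T J K yh vh
           \<and> weakly_converges (\<lambda>n. T (p n)) (T yh)
           \<and> weakly_converges (\<lambda>n. J (v n)) (J vh)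
           \<and> (range (adjoint T) = UNIV \<longrightarrow> weakly_converges p yh)
           \<and> (range (adjoint J) = UNIV \<longrightarrow> weakly_converges v vh)"
proof -
  note g = assms(1) and h = assms(2) and T = assms(3) and J = assms(5) and K = assms(7)
  note y_eq = assms(23) and argmin_p = assms(24) and argmin_v = assms(25) and x_Suc = assms(26)
  note \<Sigma> = strongly_monotone_inverse[OF assms(13-15)]
  note \<Upsilon> = strongly_monotone_inverse[OF assms(16-18)]
  interpret K: bounded_linear K by (rule K)
  interpret S: bounded_linear "inv \<Sigma>" by (rule \<Sigma>(5))
  interpret R: bounded_linear "inv \<Upsilon>" by (rule \<Upsilon>(5))
  interpret U: linear \<Upsilon> by (rule assms(16))
  interpret T': bounded_linear "adjoint T" by (rule adjoint_bounded_linear[OF T])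
  interpret J': bounded_linear "adjoint J" by (rule adjoint_bounded_linear[OF J])
  let ?K = "adjoint K"
  define \<phi> where "\<phi> = (\<lambda>s. fenchel_conjugate g (adjoint T s))"
  define \<psi> where "\<psi> = (\<lambda>s. fenchel_conjugate h (adjoint J s))"
  have nonneg: "0 \<le> z \<bullet> A z" if "strongly_monotone A" for A :: "'z::real_inner \<Rightarrow> 'z" and z
    using that unfolding strongly_monotone_def
    by (meson mult_nonneg_nonneg less_imp_le order_trans zero_le_power2)
  define a where "a = (\<lambda>n. T (p (Suc n)))"

  have Jv: "J (v (Suc n)) = inv \<Upsilon> (x (Suc n) - x n) - K (a n)" for n
    using x_Suc[of n] \<Upsilon>(2) by (simp add: a_def)
  have step_\<psi>: "is_subgradient \<psi> (- x (Suc n)) (J (v (Suc n)))" for n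
  proof -
    have "is_subgradient h (v (Suc n))
      (- adjoint J (\<Upsilon> (J (v (Suc n)) - (- (K (T (p (Suc n))) + inv \<Upsilon> (x n))))))"
      by (rule argmin_subgradient[OF h J assms(16,17) nonneg[OF assms(18)]])
        (use argmin_v[of n] in \<open>simp only: diff_minus_eq_add add.assoc\<close>)
    moreover have "\<Upsilon> (J (v (Suc n)) - (- (K (T (p (Suc n))) + inv \<Upsilon> (x n)))) = x (Suc n)"
      unfolding diff_minus_eq_add U.add \<Upsilon>(1) x_Suc[of n] by (simp add: ac_simps)
    ultimately show ?thesis
      unfolding \<psi>_def by (intro is_subgradient_conjugate_compose_adjoint J) (simp add: J'.neg)
  qed
  have step_\<phi>: "is_subgradient \<phi>
      (- (inv \<Sigma> (a (Suc n) - a n) + ?K (2 *\<^sub>R x (Suc n) - x n))) (a (Suc n))" for n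
  proof -
    \<comment> \<open>The update of \<open>x\<close> says that the term added to
      \<open>x (Suc n)\<close> in \<open>y (Suc n)\<close> is the last increment of
      \<open>x\<close>. There is no such relation for \<open>y 0\<close>, hence the shift in
      \<open>a\<close>.\<close>
    have y: "y (Suc n) = 2 *\<^sub>R x (Suc n) - x n"
      using y_eq[of "Suc n"] x_Suc[of n] by (simp add: scaleR_2)
    have "is_subgradient g (p (Suc (Suc n)))
      (- adjoint T (inv \<Sigma> (T (p (Suc (Suc n))) - (T (p (Suc n)) - \<Sigma> (?K (y (Suc n)))))))"
      by (rule argmin_subgradient[OF g T \<Sigma>(3,4) nonneg[OF \<Sigma>(6)] argmin_p])
    moreover have "inv \<Sigma> (T (p (Suc (Suc n))) - (T (p (Suc n)) - \<Sigma> (?K (y (Suc n))))) =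
        inv \<Sigma> (a (Suc n) - a n) + ?K (2 *\<^sub>R x (Suc n) - x n)"
      by (simp add: a_def S.diff \<Sigma>(2) flip: y)
    ultimately show ?thesis
      unfolding \<phi>_def a_def by (intro is_subgradient_conjugate_compose_adjoint T) (simp only: T'.neg a_def)
  qed

  \<comment> \<open>Completing the square: the form equals that of \<open>inv \<Upsilon>\<close> at
    \<open>w + \<Upsilon> (K u)\<close> plus that of \<open>inv \<Sigma> - K* \<Upsilon> K\<close>
    at \<open>u\<close>.\<close>
  have pos: "0 \<le> u \<bullet> inv \<Sigma> u + 2 * (K u \<bullet> w) + w \<bullet> inv \<Upsilon> w" for u w
  proof -
    have "0 \<le> (u - 0) \<bullet> ((inv \<Sigma> u - ?K (\<Upsilon> (K u))) - (inv \<Sigma> 0 - ?K (\<Upsilon> (K 0))))"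
      using assms(19) unfolding monotone_operator_def by blast
    moreover have "?K 0 = 0" using adjoint_bounded_linear[OF K] by (simp add: linear_0 bounded_linear.linear)
    ultimately have "K u \<bullet> \<Upsilon> (K u) \<le> u \<bullet> inv \<Sigma> u"
      by (simp add: inner_diff_right S.zero K.zero U.zero adjoint_inner[OF K])
    moreover have "0 \<le> (w + \<Upsilon> (K u)) \<bullet> inv \<Upsilon> (w + \<Upsilon> (K u))" by (rule nonneg[OF \<Upsilon>(6)])
    moreover have "\<dots> = w \<bullet> inv \<Upsilon> w + 2 * (K u \<bullet> w) + K u \<bullet> \<Upsilon> (K u)"
    proof -
      have "\<Upsilon> (K u) \<bullet> inv \<Upsilon> w = K u \<bullet> w"
        using assms(17) \<Upsilon>(1) by (simp add: self_adjoint_def)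
      then show ?thesis
        by (simp add: R.add \<Upsilon>(2) inner_add_left inner_add_right inner_commute)
    qed
    ultimately show ?thesis by linarith
  qed

  obtain y1 v1 where sol: "solves_Q g h T J K y1 v1" using assms(12) by blast
  have KT: "bounded_linear (\<lambda>u. K (T u))" by (rule bounded_linear_compose[OF K T])
  have "\<exists>\<xi>. is_subgradient g y1 (- adjoint (\<lambda>u. K (T u)) \<xi>) \<and> is_subgradient h v1 (- adjoint J \<xi>)"
    using sol by (intro Lagrange_multiplier[OF g h KT J assms(11)])
      (auto simp: solves_Q_def is_arg_min_linorder)
  moreover have "adjoint (\<lambda>u. K (T u)) = (\<lambda>z. adjoint T (?K z))"
    by (intro adjoint_unique allI) (simp add: adjoint_inner[OF K] adjoint_inner[OF T])
  ultimately obtain \<xi> where \<xi>: "is_subgradient g y1 (adjoint T (- ?K \<xi>))" "is_subgradient h v1 (adjoint J (- \<xi>))"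
    by (auto simp: T'.neg J'.neg)
  have Jv1: "J v1 = - K (T y1)"
    using sol by (auto simp: solves_Q_def is_arg_min_def add_eq_0_iff)
  have saddle: "is_subgradient \<phi> (- ?K \<xi>) (T y1)" "is_subgradient \<psi> (- \<xi>) (- K (T y1))"
    using is_subgradient_conjugate_compose_adjoint[OF T \<xi>(1)]
      is_subgradient_conjugate_compose_adjoint[OF J \<xi>(2)] Jv1 by (simp_all add: \<phi>_def \<psi>_def)

  have epi: "closed (epi \<phi>)" "convex (epi \<phi>)" "closed (epi \<psi>)" "convex (epi \<psi>)"
    unfolding \<phi>_def \<psi>_def
    by (intro epi_conjugate_compose T'.bounded_linear_axioms J'.bounded_linear_axioms)+
  obtain a' x' where sub: "is_subgradient \<phi> (- ?K x') a'" "is_subgradient \<psi> (- x') (- K a')"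
    and lim: "weakly_converges a a'"
      "weakly_converges (\<lambda>n. inv \<Upsilon> (x (Suc n) - x n) - K (a n)) (- K a')"
    using primal_dual_weak_convergence[where a = a and x = x, OF epi K \<Sigma>(5,4,6) \<Upsilon>(5,4,6) pos
        step_\<psi>[unfolded Jv] step_\<phi> saddle] by blast
  obtain yh where yh: "T yh = a'" "is_subgradient g yh (adjoint T (- ?K x'))"
    using subgradient_conjugate_compose_adjoint[OF g T assms(9) sub(1)[unfolded \<phi>_def]] by blast
  obtain vh where vh: "J vh = - K a'" "is_subgradient h vh (adjoint J (- x'))"
    using subgradient_conjugate_compose_adjoint[OF h J assms(10) sub(2)[unfolded \<psi>_def]] by blast
  have "solves_Q g h T J K yh vh"
    by (rule saddle_point_solves_Q[OF g h T J K yh(2) vh(2)]) (simp add: yh(1) vh(1))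
  moreover have shift: "weakly_converges X l" if "weakly_converges (\<lambda>n. X (Suc n)) l"
    for X and l :: "'z::real_inner"
    using that unfolding weakly_converges_def by (auto intro: LIMSEQ_imp_Suc)
  have Tp: "weakly_converges (\<lambda>n. T (p n)) (T yh)"
    by (rule shift) (use lim(1) in \<open>simp add: a_def yh(1)\<close>)
  have Jv_lim: "weakly_converges (\<lambda>n. J (v n)) (J vh)"
    by (rule shift) (use lim(2) in \<open>simp add: Jv vh(1)\<close>)
  ultimately show ?thesis
    using Tp Jv_lim weakly_converges_preimage[OF T _ Tp] weakly_converges_preimage[OF J _ Jv_lim]
    by blast
qed

end
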